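(* Let $\varepsilon>0$ and let $c\in\mathscr{K}$ be piecewise constant: there exist $0=h_{-1}<h_0<h_1<\cdots<h_N=H$ and positive constants $c_0,c_1,\ldots,c_N$ such that $c(y)=c_{j+1}$ for $y\in(h_j,h_{j+1})$, $j=-1,0,\ldots,N-1$. Let $$V=\sum_{j=0}^{N-1}|c_{j+1}-c_j|$$ be the total variation of $c$. Let $u_{\lambda,k}$, $(\mu_k,\lambda)\in\mathscr{A}^c_\varepsilon$, be the normalized eigenfunctions. Then: (1) $c$ satisfies the minimal amplitude hypothesis with respect to $\mathscr{A}^c_\varepsilon$, i.e. $\displaystyle\inf_{y\in[0,H],\ (\mu_k,\lambda)\in\mathscr{A}^c_\varepsilon}\big[u_{\lambda,k}(y)^2+(c(y)u_{\lambda,k}'(y))^2\big]>0$. (2) For every nonempty interval $(a,b)\subseteq[0,H]$ there exist constants $d>0$ and $\lambda_0>0$, depending only on $b-a,c_m,c_M,\varepsilon,V$, such that for all $(\mu_k,\lambda)\in\mathscr{A}^c_\varepsilon$ $$\int_a^b u_{\lambda,k}(y)^2\,dy>d,\qquad\lambda>\lambda_0.$$ In particular, $d$ and $\lambda_0$ do not depend on the size $N$ of the partition.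
   Context: $\Omega'\subset\mathbb{R}^d$ ($d\ge1$) is a fixed bounded smooth open domain and $H>0$ is fixed ($\Omega'$ and $H$ are fixed throughout; dependence of constants on them is not tracked). $\mu_1^2\le\mu_2^2\le\cdots$ (with $\mu_k>0$) are the eigenvalues, counted with multiplicity, of the Dirichlet Laplacian in $L^2(\Omega')$. Fix $0<c_m<c_M$; $\mathscr{K}$ is the set of all $c\in L^\infty([0,H])$ with $\operatorname{ess\,inf}c=c_m$ and $\operatorname{ess\,sup}c=c_M$ (so for piecewise constant $c$, $c_m$ and $c_M$ are its minimal and maximal values; they are not to be confused with the indexed values $c_j$). For $c\in\mathscr{K}$ and $k\ge1$, $$A_k=c(y)\mu_k^2-\frac{d}{dy}c(y)\frac{d}{dy}\ \text{ in }L^2(0,H),\qquad D(A_k)=\{u\in H^1_0(0,H):\ cu'\in H^1(0,H)\},$$ is self-adjoint with simple eigenvalues $\beta_{k,1}<\beta_{k,2}<\cdots$. If $\lambda=\beta_{k,\ell}$, $u_{\lambda,k}$ denotes the (real) eigenfunction of $A_k$ for $\lambda$, normalized in $L^2(0,H)$; it solves $(cu')'+(\lambda-c\mu_k^2)u=0$, $u(0)=u(H)=0$. $cu_{\lambda,k}'$ is understood as its continuous representative. $\mathscr{A}^c_\varepsilon=\bigcup_{k\ge1}\{(\mu_k,\lambda):\ \lambda=\beta_{k,\ell}\text{ for some }\ell\ge1,\ \lambda\ge(c_M+\varepsilon)\mu_k^2\}$. *)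

theory Defs
  imports "HOL-Probability.Essential_Supremum"
begin

section \<open>Smooth functions and smooth domains\<close>

text \<open>\<open>Ck_on n f S\<close> is meant for open \<open>S\<close>: all partial derivatives of order at most \<open>n\<close>
  exist and are continuous on \<open>S\<close>.\<close>

fun Ck_on :: "nat \<Rightarrow> ('a::euclidean_space \<Rightarrow> real) \<Rightarrow> 'a set \<Rightarrow> bool" where
  "Ck_on 0 f S \<longleftrightarrow> continuous_on S f"
| "Ck_on (Suc n) f S \<longleftrightarrow> (\<forall>x\<in>S. f differentiable (at x)) \<and>
     (\<forall>b\<in>Basis. Ck_on n (\<lambda>x. frechet_derivative f (at x) b) S)"

definition smooth_on :: "('a::euclidean_space \<Rightarrow> real) \<Rightarrow> 'a set \<Rightarrow> bool" where
  "smooth_on f S \<longleftrightarrow> (\<forall>n. Ck_on n f S)"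

definition grad :: "('a::euclidean_space \<Rightarrow> real) \<Rightarrow> 'a \<Rightarrow> 'a" where
  "grad f x = (\<Sum>b\<in>Basis. frechet_derivative f (at x) b *\<^sub>R b)"

text \<open>Smoothness of the boundary is expressed by local defining functions: near each boundary
  point the domain is the sublevel set of a smooth function without critical points.\<close>

definition smooth_bounded_domain :: "'a::euclidean_space set \<Rightarrow> bool" where
  "smooth_bounded_domain \<Omega> \<longleftrightarrow> open \<Omega> \<and> connected \<Omega> \<and> \<Omega> \<noteq> {} \<and> bounded \<Omega> \<and>
     (\<forall>x0\<in>frontier \<Omega>. \<exists>U \<psi>. open U \<and> x0 \<in> U \<and> smooth_on \<psi> U \<and>
        (\<forall>x\<in>U. grad \<psi> x \<noteq> 0) \<and> \<Omega> \<inter> U = {x\<in>U. \<psi> x < 0})"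


section \<open>Sobolev spaces\<close>

text \<open>Elements of \<open>L\<^sup>2\<close> are represented by functions; equality in \<open>L\<^sup>2(U)\<close> is equality almost
  everywhere with respect to \<open>lebesgue_on U\<close>.\<close>

definition L2 :: "'a::euclidean_space set \<Rightarrow> ('a \<Rightarrow> 'b::euclidean_space) set" where
  "L2 U = {f \<in> borel_measurable (lebesgue_on U). integrable (lebesgue_on U) (\<lambda>x. (norm (f x))\<^sup>2)}"

definition test_functions :: "'a::euclidean_space set \<Rightarrow> ('a \<Rightarrow> real) set" where
  "test_functions U = {\<phi>. smooth_on \<phi> UNIV \<and>
     compact (closure {x. \<phi> x \<noteq> 0}) \<and> closure {x. \<phi> x \<noteq> 0} \<subseteq> U}"

text \<open>\<open>g\<close> is the weak gradient of \<open>u\<close>, both being square integrable. For functions on \<open>real\<close>,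
  where \<open>Basis = {1}\<close>, this says that \<open>g\<close> is the weak derivative of \<open>u\<close>.\<close>

definition has_weak_grad ::
    "'a::euclidean_space set \<Rightarrow> ('a \<Rightarrow> real) \<Rightarrow> ('a \<Rightarrow> 'a) \<Rightarrow> bool" where
  "has_weak_grad U u g \<longleftrightarrow> u \<in> L2 U \<and> g \<in> L2 U \<and>
     (\<forall>\<phi>\<in>test_functions U. \<forall>b\<in>Basis.
        (LINT x|lebesgue_on U. u x * frechet_derivative \<phi> (at x) b) =
        - (LINT x|lebesgue_on U. (g x \<bullet> b) * \<phi> x))"

definition H1 :: "'a::euclidean_space set \<Rightarrow> ('a \<Rightarrow> real) set" where
  "H1 U = {u. \<exists>g. has_weak_grad U u g}"

text \<open>The closure of the test functions in the norm of \<open>H\<^sup>1(U)\<close>.\<close>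

definition H10 :: "'a::euclidean_space set \<Rightarrow> ('a \<Rightarrow> real) set" where
  "H10 U = {u. \<exists>g \<phi>. has_weak_grad U u g \<and> (\<forall>n::nat. \<phi> n \<in> test_functions U) \<and>
     (\<lambda>n. LINT x|lebesgue_on U. (\<phi> n x - u x)\<^sup>2) \<longlonglongrightarrow> 0 \<and>
     (\<lambda>n. LINT x|lebesgue_on U. (norm (grad (\<phi> n) x - g x))\<^sup>2) \<longlonglongrightarrow> 0}"


section \<open>Eigenvalues of the Dirichlet Laplacian\<close>

text \<open>\<open>u\<close> lies in the domain of the Dirichlet Laplacian on \<open>\<Omega>\<close>, and \<open>-\<Delta>u = f\<close>.\<close>

definition dirichlet_laplacian ::
    "'a::euclidean_space set \<Rightarrow> ('a \<Rightarrow> real) \<Rightarrow> ('a \<Rightarrow> real) \<Rightarrow> bool" where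
  "dirichlet_laplacian \<Omega> u f \<longleftrightarrow> u \<in> H10 \<Omega> \<and> f \<in> L2 \<Omega> \<and>
     (\<exists>g. has_weak_grad \<Omega> u g \<and> (\<forall>\<phi>\<in>test_functions \<Omega>.
        (LINT x|lebesgue_on \<Omega>. g x \<bullet> grad \<phi> x) = (LINT x|lebesgue_on \<Omega>. f x * \<phi> x)))"

definition dirichlet_eigenspace :: "'a::euclidean_space set \<Rightarrow> real \<Rightarrow> ('a \<Rightarrow> real) set" where
  "dirichlet_eigenspace \<Omega> s = {u. dirichlet_laplacian \<Omega> u (\<lambda>x. s * u x)}"

text \<open>The dimension of a space of functions modulo almost everywhere equality.\<close>

definition has_dim_AE :: "'a measure \<Rightarrow> ('a \<Rightarrow> real) set \<Rightarrow> nat \<Rightarrow> bool" where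
  "has_dim_AE M E n \<longleftrightarrow> (\<exists>e. (\<forall>i<n. e i \<in> E) \<and>
     (\<forall>a. (AE x in M. (\<Sum>i<n. a i * e i x) = 0) \<longrightarrow> (\<forall>i<n. a i = 0)) \<and>
     (\<forall>u\<in>E. \<exists>a. AE x in M. u x = (\<Sum>i<n. a i * e i x)))"

text \<open>\<open>\<mu> 1, \<mu> 2, \<dots>\<close> are the positive square roots of the eigenvalues in nondecreasing order,
  repeated according to multiplicity; \<open>\<mu> 0\<close> is irrelevant. Taking \<open>s\<close> outside the
  spectrum, the last clause says that no \<open>\<mu> k\<close> squared equals \<open>s\<close>.\<close>

definition dirichlet_frequencies :: "'a::euclidean_space set \<Rightarrow> (nat \<Rightarrow> real) \<Rightarrow> bool" where
  "dirichlet_frequencies \<Omega> \<mu> \<longleftrightarrow>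
     (\<forall>k\<ge>1. \<mu> k > 0) \<and> (\<forall>k\<ge>1. (\<mu> k)\<^sup>2 \<le> (\<mu> (Suc k))\<^sup>2) \<and>
     (\<forall>s. finite {k. k \<ge> 1 \<and> (\<mu> k)\<^sup>2 = s} \<and>
        has_dim_AE (lebesgue_on \<Omega>) (dirichlet_eigenspace \<Omega> s) (card {k. k \<ge> 1 \<and> (\<mu> k)\<^sup>2 = s}))"


section \<open>Coefficients and the one-dimensional operators\<close>

text \<open>Essential boundedness of \<open>c\<close> is implied, both essential bounds being finite.\<close>

definition coeff_class :: "real \<Rightarrow> real \<Rightarrow> real \<Rightarrow> (real \<Rightarrow> real) set" where
  "coeff_class H cm cM = {c \<in> borel_measurable (lebesgue_on {0..H}).
     - esssup (lebesgue_on {0..H}) (\<lambda>y. - ereal (c y)) = ereal cm \<and>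
     esssup (lebesgue_on {0..H}) (\<lambda>y. ereal (c y)) = ereal cM}"

text \<open>There are \<open>N + 1\<close> layers; layer \<open>i\<close> is the interval \<open>(h i, h (Suc i))\<close>, with \<open>h 0 = 0\<close> and
  \<open>h (Suc N) = H\<close>, and carries the value \<open>q i\<close>. The values of \<open>c\<close> at the interfaces are free.\<close>

definition piecewise_const ::
    "real \<Rightarrow> nat \<Rightarrow> (nat \<Rightarrow> real) \<Rightarrow> (nat \<Rightarrow> real) \<Rightarrow> (real \<Rightarrow> real) \<Rightarrow> bool" where
  "piecewise_const H N h q c \<longleftrightarrow> h 0 = 0 \<and> h (Suc N) = H \<and> (\<forall>i\<le>N. h i < h (Suc i)) \<and>
     (\<forall>i\<le>N. q i > 0) \<and> (\<forall>i\<le>N. \<forall>y\<in>{h i<..<h (Suc i)}. c y = q i)"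

definition total_variation :: "nat \<Rightarrow> (nat \<Rightarrow> real) \<Rightarrow> real" where
  "total_variation N q = (\<Sum>j<N. \<bar>q (Suc j) - q j\<bar>)"

text \<open>The operator \<open>c m\<^sup>2 - (d/dy) c (d/dy)\<close> as a relation: \<open>u\<close> lies in its domain and is
  mapped to \<open>f\<close>. Here \<open>v = u'\<close> and \<open>w = (c u')'\<close>.\<close>

definition A_op ::
    "real \<Rightarrow> (real \<Rightarrow> real) \<Rightarrow> real \<Rightarrow> (real \<Rightarrow> real) \<Rightarrow> (real \<Rightarrow> real) \<Rightarrow> bool" where
  "A_op H c m u f \<longleftrightarrow> u \<in> H10 {0<..<H} \<and>
     (\<exists>v w. has_weak_grad {0<..<H} u v \<and> has_weak_grad {0<..<H} (\<lambda>y. c y * v y) w \<and>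
        (AE y in lebesgue_on {0<..<H}. f y = c y * m\<^sup>2 * u y - w y))"

definition A_eigenvalues :: "real \<Rightarrow> (real \<Rightarrow> real) \<Rightarrow> real \<Rightarrow> real set" where
  "A_eigenvalues H c m = {l. \<exists>u. A_op H c m u (\<lambda>y. l * u y) \<and>
     \<not> (AE y in lebesgue_on {0<..<H}. u y = 0)}"

text \<open>\<open>l\<close> is the \<open>n\<close>-th smallest eigenvalue, counting from \<open>1\<close> (the eigenvalues are simple).\<close>

definition nth_eigenvalue :: "real \<Rightarrow> (real \<Rightarrow> real) \<Rightarrow> real \<Rightarrow> nat \<Rightarrow> real \<Rightarrow> bool" where
  "nth_eigenvalue H c m n l \<longleftrightarrow> l \<in> A_eigenvalues H c m \<and>
     finite {l' \<in> A_eigenvalues H c m. l' < l} \<and>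
     Suc (card {l' \<in> A_eigenvalues H c m. l' < l}) = n"

definition A_set ::
    "(nat \<Rightarrow> real) \<Rightarrow> real \<Rightarrow> (real \<Rightarrow> real) \<Rightarrow> real \<Rightarrow> real \<Rightarrow> (real \<times> real) set" where
  "A_set \<mu> H c cM \<epsilon> = (\<Union>k\<in>{1..}. {(\<mu> k, l) | l.
     (\<exists>n\<ge>1. nth_eigenvalue H c (\<mu> k) n l) \<and> l \<ge> (cM + \<epsilon>) * (\<mu> k)\<^sup>2})"

text \<open>\<open>u\<close> and \<open>p\<close> are the continuous representatives on \<open>[0,H]\<close> of an eigenfunction with unit
  norm in \<open>L\<^sup>2(0,H)\<close> and of \<open>c u'\<close>.\<close>

definition normalized_eigenfunction ::
    "real \<Rightarrow> (real \<Rightarrow> real) \<Rightarrow> real \<Rightarrow> real \<Rightarrow> (real \<Rightarrow> real) \<Rightarrow> (real \<Rightarrow> real) \<Rightarrow> bool" where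
  "normalized_eigenfunction H c m l u p \<longleftrightarrow>
     A_op H c m u (\<lambda>y. l * u y) \<and> (LINT y|lebesgue_on {0<..<H}. (u y)\<^sup>2) = 1 \<and>
     continuous_on {0..H} u \<and> continuous_on {0..H} p \<and>
     (\<exists>v. has_weak_grad {0<..<H} u v \<and> (AE y in lebesgue_on {0<..<H}. p y = c y * v y))"

text \<open>\<open>u k l\<close> is determined only up to sign, so the family is quantified over.\<close>

definition eigenfunction_family ::
    "(nat \<Rightarrow> real) \<Rightarrow> real \<Rightarrow> (real \<Rightarrow> real) \<Rightarrow> real \<Rightarrow> real \<Rightarrow>
     (nat \<Rightarrow> real \<Rightarrow> real \<Rightarrow> real) \<Rightarrow> (nat \<Rightarrow> real \<Rightarrow> real \<Rightarrow> real) \<Rightarrow> bool" where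
  "eigenfunction_family \<mu> H c cM \<epsilon> u p \<longleftrightarrow>
     (\<forall>k\<ge>1. \<forall>l. (\<mu> k, l) \<in> A_set \<mu> H c cM \<epsilon> \<longrightarrow>
        normalized_eigenfunction H c (\<mu> k) l (u k l) (p k l))"

text \<open>The infimum is taken in the extended reals.\<close>

definition minimal_amplitude ::
    "(nat \<Rightarrow> real) \<Rightarrow> real \<Rightarrow> (real \<times> real) set \<Rightarrow>
     (nat \<Rightarrow> real \<Rightarrow> real \<Rightarrow> real) \<Rightarrow> (nat \<Rightarrow> real \<Rightarrow> real \<Rightarrow> real) \<Rightarrow> bool" where
  "minimal_amplitude \<mu> H A u p \<longleftrightarrow>
     0 < (INF (y, k, l) \<in> {(y, k, l). y \<in> {0..H} \<and> k \<ge> 1 \<and> (\<mu> k, l) \<in> A}.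
            ereal ((u k l y)\<^sup>2 + (p k l y)\<^sup>2))"

end

theory Submission
  imports Defs
begin

text \<open>
  Inside a layer with coefficient \<open>q\<close> an eigenfunction satisfies \<open>q u'' + (\<lambda> - q \<mu>\<^sup>2) u = 0\<close> with
  \<open>\<lambda> - q \<mu>\<^sup>2 > 0\<close>, an oscillator whose energy \<open>E = (\<lambda> - q \<mu>\<^sup>2) u\<^sup>2 + (q u')\<^sup>2 / q\<close> is constant on the
  layer. At an interface \<open>u\<close> and the flux \<open>p = c u'\<close> are continuous, so only the weights in \<open>E\<close> jump.
  Because \<open>\<lambda> - q \<mu>\<^sup>2 \<ge> \<epsilon> \<mu>\<^sup>2\<close> and \<open>q \<ge> c\<^sub>m\<close>, a jump of size \<open>J\<close> of the coefficient changes the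
  energy by a factor of at most \<open>exp(K J)\<close> with \<open>K = 1/\<epsilon> + 1/c\<^sub>m\<close>. The factors multiply: the
  energies of any two layers differ by a factor of at most \<open>F = exp(K V)\<close>, however many layers there
  are (\<open>layer_energies_comparable\<close>).

  With \<open>\<delta> = \<epsilon> / (c\<^sub>M + \<epsilon>)\<close> one has \<open>\<delta> \<lambda> \<le> \<lambda> - q \<mu>\<^sup>2 \<le> \<lambda>\<close>. Hence \<open>u\<^sup>2 \<le> E / (\<delta> \<lambda>)\<close>, and the
  normalization forces \<open>E \<ge> \<delta> \<lambda> / (F H)\<close> in every layer (\<open>energy_lower_bound\<close>). Since
  \<open>E \<le> \<lambda> u\<^sup>2 + p\<^sup>2 / c\<^sub>m\<close>, this bounds \<open>u\<^sup>2 + p\<^sup>2 / (\<lambda> c\<^sub>m)\<close> from below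
  (\<open>amplitude_lower_bound\<close>), and the first claim follows as \<open>\<lambda> \<ge> (c\<^sub>M + \<epsilon>) \<mu>\<^sub>1\<^sup>2\<close>.

  For the second claim, \<open>(u p)' = E - 2 (\<lambda> - q \<mu>\<^sup>2) u\<^sup>2\<close> holds on every layer and \<open>u p\<close> is continuous,
  so on \<open>(a,b)\<close> the integral of \<open>2 \<lambda> u\<^sup>2\<close> is at least that of \<open>E\<close> minus the boundary terms of \<open>u p\<close>
  (\<open>equipartition\<close>). Those are of order \<open>E / sqrt \<lambda>\<close> (\<open>flux_bound\<close>), whereas the integral of \<open>E\<close>
  is of order \<open>E (b - a)\<close>; the former lose for large \<open>\<lambda>\<close> (\<open>mass_lower_bound\<close>).

  What precedes this argument is the regularity that it takes for granted: eigenfunctions are given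
  through weak derivatives, and it must be shown that \<open>u\<close> and \<open>p\<close> are differentiable inside the layers
  (\<open>eigenfunction_layer_equations\<close>). This rests on a fundamental theorem of calculus for weak
  derivatives (\<open>weak_derivative_FTC\<close>), obtained by testing with smooth approximations of indicator
  functions, which are constructed from \<open>exp(-1/x)\<close>.
\<close>

section \<open>A smooth step function\<close>

lemma poly_exp_tendsto_0: "((\<lambda>t::real. poly q t * exp (- t)) \<longlongrightarrow> 0) at_top"
proof -
  have eq: "(\<lambda>t::real. poly q t * exp (- t)) = (\<lambda>t. \<Sum>i\<le>degree q. coeff q i * (t ^ i / exp t))"
    by (auto simp: poly_altdef exp_minus sum_distrib_right sum_divide_distrib field_simps)
  have "((\<lambda>t::real. \<Sum>i\<le>degree q. coeff q i * (t ^ i / exp t)) \<longlongrightarrow> (\<Sum>i\<le>degree q. coeff q i * 0)) at_top"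
    by (intro tendsto_intros tendsto_power_div_exp_0)
  then show ?thesis by (simp add: eq)
qed

text \<open>The functions \<open>q(1/x) exp(-1/x)\<close>, extended by \<open>0\<close> to \<open>x \<le> 0\<close>: carrying the polynomial
  \<open>q\<close> along makes the family closed under differentiation, so that the smoothness of
  \<open>exp(-1/x)\<close> needs a single derivative computation.\<close>

definition flat :: "real poly \<Rightarrow> real \<Rightarrow> real" where
  "flat q x = (if x > 0 then poly q (1 / x) * exp (- (1 / x)) else 0)"

lemma flat_has_derivative:
  "(flat q has_real_derivative flat (monom 1 2 * (q - pderiv q)) x) (at x)"
proof -
  consider "x < 0" | "x > 0" | "x = 0" by linarith
  then show ?thesis
  proof cases
    case 1
    have "((\<lambda>_. 0) has_real_derivative 0) (at x)" by simp
    then have "(flat q has_real_derivative 0) (at x)"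
      by (rule has_field_derivative_transform_within_open[where S="{..<0}"])
         (use 1 in \<open>auto simp: flat_def\<close>)
    then show ?thesis using 1 by (simp add: flat_def)
  next
    case 2
    have "((\<lambda>x. poly q (1 / x) * exp (- (1 / x))) has_real_derivative
        flat (monom 1 2 * (q - pderiv q)) x) (at x)"
      using 2 by (auto intro!: derivative_eq_intros DERIV_chain2[OF poly_DERIV]
          simp: flat_def poly_monom field_simps power2_eq_square)
    then show ?thesis
      by (rule has_field_derivative_transform_within_open[where S="{0<..}"])
         (use 2 in \<open>auto simp: flat_def\<close>)
  next
    case 3
    have "((\<lambda>h. flat q h / h) \<longlongrightarrow> 0) (at_right 0)"
    proof (rule Lim_transform_eventually)
      have "((\<lambda>h. poly (q * [:0, 1:]) (inverse h) * exp (- inverse h)) \<longlongrightarrow> 0) (at_right (0::real))"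
        by (rule filterlim_compose[OF poly_exp_tendsto_0 filterlim_inverse_at_top_right])
      then show "((\<lambda>h. poly (q * [:0, 1:]) (inverse h) * exp (- inverse h)) \<longlongrightarrow> 0) (at_right (0::real))" .
      show "\<forall>\<^sub>F h in at_right 0. poly (q * [:0, 1:]) (inverse h) * exp (- inverse h) = flat q h / h"
        by (rule eventually_mono[OF eventually_at_right_less])
           (auto simp: flat_def field_simps)
    qed
    moreover have "((\<lambda>h. flat q h / h) \<longlongrightarrow> 0) (at_left 0)"
      by (rule Lim_transform_eventually[OF tendsto_const])
         (auto simp: eventually_at_left_real flat_def intro!: eventually_at_leftI[of "-1"])
    ultimately have "((\<lambda>h. flat q h / h) \<longlongrightarrow> 0) (at 0)"
      by (simp add: filterlim_split_at)
    then show ?thesis using 3 by (simp add: has_field_derivative_iff flat_def)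
  qed
qed

text \<open>A class of functions that is closed under differentiation, hence consists of smooth functions.
  It is generated by exactly the operations from which the cutoffs below are built.\<close>

inductive smooth_fun :: "(real \<Rightarrow> real) \<Rightarrow> bool" where
  flat: "smooth_fun (flat q)"
| const: "smooth_fun (\<lambda>x. k)"
| affine: "smooth_fun f \<Longrightarrow> smooth_fun (\<lambda>x. f (r * x + s))"
| add: "smooth_fun f \<Longrightarrow> smooth_fun g \<Longrightarrow> smooth_fun (\<lambda>x. f x + g x)"
| mult: "smooth_fun f \<Longrightarrow> smooth_fun g \<Longrightarrow> smooth_fun (\<lambda>x. f x * g x)"
| antiderivative: "smooth_fun f \<Longrightarrow> (\<And>x. (g has_real_derivative f x) (at x)) \<Longrightarrow> smooth_fun g"

lemma smooth_fun_derivative: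
  assumes "smooth_fun f"
  shows "\<exists>f'. smooth_fun f' \<and> (\<forall>x. (f has_real_derivative f' x) (at x))"
  using assms
proof induction
  case (flat q)
  then show ?case using flat_has_derivative smooth_fun.flat by blast
next
  case (const k)
  have "((\<lambda>x. k) has_real_derivative 0) (at x)" for x by simp
  then show ?case using smooth_fun.const[of 0] by blast
next
  case (affine f r s)
  then obtain f' where f': "smooth_fun f'" "\<And>x. (f has_real_derivative f' x) (at x)" by blast
  have "((\<lambda>x. f (r * x + s)) has_real_derivative f' (r * x + s) * r) (at x)" for x
    by (rule DERIV_chain2[OF f'(2)]) (auto intro!: derivative_eq_intros)
  moreover have "smooth_fun (\<lambda>x. f' (r * x + s) * r)"
    by (rule smooth_fun.mult[OF smooth_fun.affine[OF f'(1)] smooth_fun.const])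
  ultimately show ?case by blast
next
  case (add f g)
  then obtain f' g' where fg: "smooth_fun f'" "\<And>x. (f has_real_derivative f' x) (at x)"
    "smooth_fun g'" "\<And>x. (g has_real_derivative g' x) (at x)" by blast
  have "((\<lambda>x. f x + g x) has_real_derivative f' x + g' x) (at x)" for x
    by (rule DERIV_add[OF fg(2) fg(4)])
  then show ?case using smooth_fun.add[OF fg(1) fg(3)] by blast
next
  case (mult f g)
  then obtain f' g' where fg: "smooth_fun f'" "\<And>x. (f has_real_derivative f' x) (at x)"
    "smooth_fun g'" "\<And>x. (g has_real_derivative g' x) (at x)" by blast
  have "((\<lambda>x. f x * g x) has_real_derivative f' x * g x + g' x * f x) (at x)" for x
    by (rule DERIV_mult[OF fg(2) fg(4)])
  moreover have "smooth_fun (\<lambda>x. f' x * g x + g' x * f x)"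
    by (rule smooth_fun.add[OF smooth_fun.mult[OF fg(1) mult.hyps(2)] smooth_fun.mult[OF fg(3) mult.hyps(1)]])
  ultimately show ?case by blast
next
  case (antiderivative f g)
  then show ?case by blast
qed

lemma smooth_fun_continuous:
  assumes "smooth_fun f"
  shows "continuous_on S f"
proof -
  obtain f' where "\<And>x. (f has_real_derivative f' x) (at x)"
    using smooth_fun_derivative[OF assms] by blast
  then show ?thesis
    by (intro continuous_at_imp_continuous_on ballI DERIV_isCont)
qed

lemma frechet_derivative_real:
  assumes "(f has_real_derivative D) (at x)"
  shows "frechet_derivative f (at x) 1 = D"
  using frechet_derivative_at[OF assms[unfolded has_field_derivative_def]] by (metis mult.right_neutral)

lemma smooth_fun_imp_smooth_on: "smooth_fun f \<Longrightarrow> smooth_on f UNIV"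
proof -
  have "Ck_on n f UNIV" if "smooth_fun f" for n f
    using that
  proof (induction n arbitrary: f)
    case 0
    then show ?case by (simp add: smooth_fun_continuous)
  next
    case (Suc n)
    obtain f' where f': "smooth_fun f'" "\<And>x. (f has_real_derivative f' x) (at x)"
      using smooth_fun_derivative[OF Suc.prems] by blast
    have eq: "(\<lambda>x. frechet_derivative f (at x) 1) = f'"
      using frechet_derivative_real[OF f'(2)] by (rule ext)
    have "f differentiable (at x)" for x
      using f'(2)[of x] unfolding differentiable_def has_field_derivative_def by blast
    then show ?case using Suc.IH[OF f'(1)] by (simp add: eq)
  qed
  then show "smooth_fun f \<Longrightarrow> smooth_on f UNIV" by (simp add: smooth_on_def)
qed

text \<open>Integrate the bump \<open>exp(-1/x) exp(-1/(1-x))\<close>, which vanishes outside \<open>(0,1)\<close>, and normalize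
  the total increase to \<open>1\<close>.\<close>

lemma smooth_step_exists:
  obtains \<Psi> \<psi> :: "real \<Rightarrow> real"
  where "smooth_fun \<Psi>" "\<And>x. (\<Psi> has_real_derivative \<psi> x) (at x)"
    "continuous_on UNIV \<psi>" "\<And>x. \<psi> x \<ge> 0" "\<And>x. x \<notin> {0<..<1} \<Longrightarrow> \<psi> x = 0"
    "\<And>x. x \<le> 0 \<Longrightarrow> \<Psi> x = 0" "\<And>x. x \<ge> 1 \<Longrightarrow> \<Psi> x = 1" "\<And>x. 0 \<le> \<Psi> x" "\<And>x. \<Psi> x \<le> 1"
proof -
  define b where "b x = flat 1 x * flat 1 (- 1 * x + 1)" for x
  have sb: "smooth_fun b"
    unfolding b_def
    by (rule smooth_fun.mult[OF smooth_fun.flat smooth_fun.affine[OF smooth_fun.flat]])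
  have bcont: "continuous_on S b" for S
    by (rule smooth_fun_continuous[OF sb])
  have b0: "b x \<ge> 0" "x \<notin> {0<..<1} \<Longrightarrow> b x = 0" "x \<in> {0<..<1} \<Longrightarrow> b x > 0" for x
    by (auto simp: b_def flat_def)
  \<comment> \<open>Starting to the left of \<open>0\<close> keeps the possibly nonsmooth end of the integration away from
    the region where \<open>b\<close> is nonzero.\<close>
  define F where "F x = integral {- 1..x} b" for x
  have F0: "F x = 0" if "x \<le> 0" for x
    unfolding F_def by (rule integral_unique, rule has_integral_is_0) (use that b0(2) in auto)
  have Fd: "(F has_real_derivative b x) (at x)" for x
  proof (cases "x < 0")
    case True
    have "((\<lambda>_. 0) has_real_derivative 0) (at x)" by simp
    then have "(F has_real_derivative 0) (at x)"
      by (rule has_field_derivative_transform_within_open[where S="{..<0}"])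
         (use True F0 in auto)
    then show ?thesis using True b0(2)[of x] by simp
  next
    case False
    have "(F has_real_derivative b x) (at x within {- 1..x + 1})"
      unfolding F_def by (rule integral_has_real_derivative[OF bcont]) (use False in auto)
    then show ?thesis
      using False at_within_Icc_at[of "-1" x "x + 1"] by simp
  qed
  have Fc: "continuous_on S F" for S
    by (intro continuous_at_imp_continuous_on ballI DERIV_isCont[OF Fd])
  have mono: "F x \<le> F y" if "x \<le> y" for x y
    using DERIV_nonneg_imp_nondecreasing[OF that] Fd b0(1) by blast
  have "F 0 < F 1"
  proof (rule DERIV_pos_imp_increasing_open[OF zero_less_one _ Fc])
    fix x :: real assume "0 < x" "x < 1"
    then show "\<exists>y. (F has_real_derivative y) (at x) \<and> 0 < y"
      using Fd[of x] b0(3)[of x] by auto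
  qed
  then have F1: "F 1 > 0" using F0[of 0] by simp
  have Fconst: "F x = F 1" if "x \<ge> 1" for x
  proof (cases "x = 1")
    case False
    then have "1 < x" using that by simp
    moreover have "(F has_real_derivative 0) (at t)" if "1 < t" for t
      using Fd[of t] b0(2)[of t] that by simp
    ultimately show ?thesis
      using DERIV_isconst_end[of 1 x F] Fc by blast
  qed simp
  show ?thesis
  proof
    show "smooth_fun (\<lambda>x. F x * (1 / F 1))"
      by (rule smooth_fun.mult[OF smooth_fun.antiderivative[OF sb Fd] smooth_fun.const])
    show "((\<lambda>x. F x * (1 / F 1)) has_real_derivative b x * (1 / F 1)) (at x)" for x
      using DERIV_cmult_right[OF Fd] .
    show "continuous_on UNIV (\<lambda>x. b x * (1 / F 1))"
      by (intro continuous_intros bcont)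
    show "0 \<le> F x * (1 / F 1)" for x
      using F1 mono[of 0 x] F0[of x] F0[of 0] by (cases "x \<le> 0") auto
    show "F x * (1 / F 1) \<le> 1" for x
      using F1 mono[of x 1] Fconst[of x] by (cases "x \<le> 1") auto
    show "F x * (1 / F 1) = 1" if "1 \<le> x" for x
      using Fconst[OF that] F1 by simp
  qed (use b0 F0 F1 in auto)
qed

section \<open>Weak derivatives of continuous functions\<close>

lemma lebesgue_on_concentrated:
  fixes f :: "real \<Rightarrow> real"
  assumes sub: "{c..d} \<subseteq> {a<..<b}" and cont: "continuous_on {c..d} f"
    and zero: "\<And>t. t \<notin> {c..d} \<Longrightarrow> f t = 0"
  shows "integrable (lebesgue_on {a<..<b}) f" "integral\<^sup>L (lebesgue_on {a<..<b}) f = integral {c..d} f"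
proof -
  have i: "integrable (lebesgue_on {c..d}) f"
    by (rule continuous_imp_integrable_real[OF cont])
  have eq: "(\<lambda>x. indicator {c..d} x *\<^sub>R f x) = (\<lambda>x. indicator {a<..<b} x *\<^sub>R f x)"
    using sub zero by (auto simp: indicator_def fun_eq_iff)
  show "integrable (lebesgue_on {a<..<b}) f"
    using i by (simp add: integrable_restrict_space eq del: real_scaleR_def)
  have "integral\<^sup>L (lebesgue_on {a<..<b}) f = integral\<^sup>L (lebesgue_on {c..d}) f"
    by (simp add: integral_restrict_space eq del: real_scaleR_def)
  then show "integral\<^sup>L (lebesgue_on {a<..<b}) f = integral {c..d} f"
    using lebesgue_integral_eq_integral[OF i] by simp
qed

text \<open>The kernels \<open>r \<psi>(r (t - y))\<close> have mass one, because \<open>\<Psi>\<close> rises from \<open>0\<close> to \<open>1\<close>, and live on the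
  interval \<open>[y, y + 1/r]\<close>, which shrinks to \<open>y\<close>.\<close>

lemma approximate_identity:
  fixes u :: "real \<Rightarrow> real"
  assumes u: "continuous_on {a<..<b} u" and y: "y \<in> {a<..<b}"
    and \<Psi>: "\<And>x. (\<Psi> has_real_derivative \<psi> x) (at x)" "\<Psi> 0 = 0" "\<Psi> 1 = 1"
    and \<psi>: "continuous_on UNIV \<psi>" "\<And>x. \<psi> x \<ge> 0" "\<And>x. x \<notin> {0<..<1} \<Longrightarrow> \<psi> x = 0"
    and r: "filterlim r at_top sequentially" "\<And>n. r n > 0" "\<And>n. y + 1 / r n < b"
  shows "\<And>n. integrable (lebesgue_on {a<..<b}) (\<lambda>t. u t * (r n * \<psi> (r n * (t - y))))"
    "(\<lambda>n. LINT t|lebesgue_on {a<..<b}. u t * (r n * \<psi> (r n * (t - y)))) \<longlonglongrightarrow> u y"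
proof -
  let ?d = "\<lambda>n. y + 1 / r n"
  have sub: "{y..?d n} \<subseteq> {a<..<b}" for n
    using y r(3)[of n] by auto
  have ker: "continuous_on S (\<lambda>t. r n * \<psi> (r n * (t - y)))" for S n
    by (intro continuous_intros continuous_on_compose2[OF \<psi>(1)]) auto
  have cont: "continuous_on {y..?d n} (\<lambda>t. u t * (r n * \<psi> (r n * (t - y))))" for n
    by (intro continuous_on_mult continuous_on_subset[OF u sub] ker)
  have zero: "u t * (r n * \<psi> (r n * (t - y))) = 0" if "t \<notin> {y..?d n}" for t n
  proof -
    have "r n * (t - y) \<notin> {0<..<1}"
      using that r(2)[of n] by (auto simp: field_simps zero_less_mult_iff)
    then show ?thesis using \<psi>(3) by simp
  qed
  show "integrable (lebesgue_on {a<..<b}) (\<lambda>t. u t * (r n * \<psi> (r n * (t - y))))" for n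
    by (rule lebesgue_on_concentrated(1)[OF sub cont zero])
  have int: "(LINT t|lebesgue_on {a<..<b}. u t * (r n * \<psi> (r n * (t - y))))
      = integral {y..?d n} (\<lambda>t. u t * (r n * \<psi> (r n * (t - y))))" for n
    by (rule lebesgue_on_concentrated(2)[OF sub cont zero])
  have mass: "((\<lambda>t. r n * \<psi> (r n * (t - y))) has_integral 1) {y..?d n}" for n
  proof -
    have "((\<lambda>t. r n * \<psi> (r n * (t - y))) has_integral
        \<Psi> (r n * (?d n - y)) - \<Psi> (r n * (y - y))) {y..?d n}"
    proof (rule fundamental_theorem_of_calculus)
      show "y \<le> ?d n" using r(2)[of n] by simp
      fix t
      have "((\<lambda>t. \<Psi> (r n * (t - y))) has_real_derivative \<psi> (r n * (t - y)) * r n) (at t)"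
        by (rule DERIV_chain2[OF \<Psi>(1)]) (auto intro!: derivative_eq_intros)
      then show "((\<lambda>t. \<Psi> (r n * (t - y))) has_vector_derivative r n * \<psi> (r n * (t - y)))
          (at t within {y..?d n})"
        by (simp add: has_real_derivative_iff_has_vector_derivative mult.commute
            has_vector_derivative_at_within)
    qed
    then show ?thesis using r(2)[of n] \<Psi>(2,3) by simp
  qed
  show "(\<lambda>n. LINT t|lebesgue_on {a<..<b}. u t * (r n * \<psi> (r n * (t - y)))) \<longlonglongrightarrow> u y"
    unfolding int
  proof (rule LIMSEQ_I)
    fix e :: real assume e: "e > 0"
    have "isCont u y"
      using u y by (simp add: continuous_on_eq_continuous_at)
    then obtain s where s: "s > 0" "\<And>t. \<bar>t - y\<bar> < s \<Longrightarrow> \<bar>u t - u y\<bar> < e / 2"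
      using e unfolding continuous_at_eps_delta dist_real_def by (meson half_gt_zero)
    have "eventually (\<lambda>n. r n > 1 / s) sequentially"
      using r(1) by (simp add: filterlim_at_top_dense)
    then obtain n0 where n0: "\<And>n. n \<ge> n0 \<Longrightarrow> r n > 1 / s"
      by (auto simp: eventually_sequentially)
    have "\<bar>integral {y..?d n} (\<lambda>t. u t * (r n * \<psi> (r n * (t - y)))) - u y\<bar> < e" if "n \<ge> n0" for n
    proof -
      let ?k = "\<lambda>t. r n * \<psi> (r n * (t - y))"
      have small: "1 / r n < s"
        using n0[OF that] s(1) r(2)[of n] by (simp add: field_simps)
      have 1: "((\<lambda>t. u t * ?k t) has_integral integral {y..?d n} (\<lambda>t. u t * ?k t)) {y..?d n}"
        by (rule integrable_integral[OF integrable_continuous_real[OF cont]])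
      have 2: "((\<lambda>t. u y * ?k t) has_integral u y * 1) {y..?d n}"
        by (rule has_integral_mult_right[OF mass])
      have 3: "((\<lambda>t. u t * ?k t - u y * ?k t) has_integral
            integral {y..?d n} (\<lambda>t. u t * ?k t) - u y * 1) {y..?d n}"
        by (rule has_integral_diff[OF 1 2])
      have 4: "((\<lambda>t. e / 2 * ?k t) has_integral e / 2 * 1) {y..?d n}"
        by (rule has_integral_mult_right[OF mass])
      have "norm (u t * ?k t - u y * ?k t) \<le> e / 2 * ?k t" if t: "t \<in> {y..?d n}" for t
      proof -
        have "\<bar>u t - u y\<bar> \<le> e / 2" using s(2)[of t] small t by auto
        moreover have k: "?k t \<ge> 0" using r(2)[of n] \<psi>(2) by simp
        ultimately have "\<bar>u t - u y\<bar> * ?k t \<le> e / 2 * ?k t" by (rule mult_right_mono)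
        moreover have "u t * ?k t - u y * ?k t = (u t - u y) * ?k t" by (simp add: left_diff_distrib)
        moreover have "norm ((u t - u y) * ?k t) = \<bar>u t - u y\<bar> * ?k t"
          by (metis k abs_mult abs_of_nonneg real_norm_def)
        ultimately show ?thesis by presburger
      qed
      then have "norm (integral {y..?d n} (\<lambda>t. u t * ?k t) - u y * 1) \<le> e / 2 * 1"
        using integral_norm_bound_integral[OF has_integral_integrable[OF 3] has_integral_integrable[OF 4]]
        unfolding integral_unique[OF 3] integral_unique[OF 4] by blast
      then show ?thesis using e by simp
    qed
    then show "\<exists>n0. \<forall>n\<ge>n0. norm (integral {y..?d n} (\<lambda>t. u t * (r n * \<psi> (r n * (t - y)))) - u y) < e"
      by auto
  qed
qed

lemma L2_interval_integrable:
  fixes v :: "real \<Rightarrow> real"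
  assumes "v \<in> L2 {a<..<b}"
  shows "integrable (lebesgue_on {a<..<b}) v"
proof (rule Bochner_Integration.integrable_bound)
  have "integrable (lebesgue_on {a<..<b}) (\<lambda>x. 1 :: real)"
    by (metis box_real(1) finite_measure.integrable_const finite_measure_lebesgue_on lmeasurable_box)
  then show "integrable (lebesgue_on {a<..<b}) (\<lambda>x. 1 + (norm (v x))\<^sup>2)"
    using assms by (auto simp: L2_def)
  show "v \<in> borel_measurable (lebesgue_on {a<..<b})" using assms by (simp add: L2_def)
  have "\<bar>t\<bar> \<le> 1 + t\<^sup>2" for t :: real
    using zero_le_power2[of "\<bar>t\<bar> - 1"] zero_le_power2[of t] by (simp add: power2_diff)
  then show "AE x in lebesgue_on {a<..<b}. norm (v x) \<le> norm (1 + (norm (v x))\<^sup>2)"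
    by simp
qed

text \<open>Test the weak equation with smooth cutoffs that converge to the indicator of
  \<open>(x1, x2]\<close>: their derivatives concentrate at the two end points and pick out the values of the
  continuous function \<open>u\<close> there, while dominated convergence applies to the integral of \<open>v\<close>.\<close>

lemma weak_derivative_FTC:
  fixes u v :: "real \<Rightarrow> real"
  assumes uv: "has_weak_grad {a<..<b} u v" and u: "continuous_on {a<..<b} u"
    and x: "a < x1" "x1 < x2" "x2 < b"
  shows "(LINT t|lebesgue_on {a<..<b}. v t * indicator {x1<..x2} t) = u x2 - u x1"
proof -
  obtain \<Psi> \<psi> :: "real \<Rightarrow> real" where
    \<Psi>: "smooth_fun \<Psi>" "\<And>x. (\<Psi> has_real_derivative \<psi> x) (at x)"
    and \<psi>: "continuous_on UNIV \<psi>" "\<And>x. \<psi> x \<ge> 0" "\<And>x. x \<notin> {0<..<1} \<Longrightarrow> \<psi> x = 0"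
    and \<Psi>01: "\<And>x. x \<le> 0 \<Longrightarrow> \<Psi> x = 0" "\<And>x. x \<ge> 1 \<Longrightarrow> \<Psi> x = 1" "\<And>x. 0 \<le> \<Psi> x" "\<And>x. \<Psi> x \<le> 1"
    using smooth_step_exists by metis
  obtain N where N: "N > 0" "1 / real N < b - x2"
    using reals_Archimedean3 x
    by (metis diff_gt_0_iff_gt nat_approx_posE zero_less_Suc)
  define r where "r n = real (n + N)" for n
  have r: "filterlim r at_top sequentially" "\<And>n. r n > 0" "\<And>n. x2 + 1 / r n < b" "\<And>n. x1 + 1 / r n < b"
  proof -
    show "filterlim r at_top sequentially"
      unfolding r_def by (rule filterlim_compose[OF filterlim_real_sequentially filterlim_add_const_nat_at_top])
    show rp: "r n > 0" for n using N by (simp add: r_def)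
    have "1 / r n \<le> 1 / real N" for n using N by (simp add: r_def field_simps)
    then show "x2 + 1 / r n < b" "x1 + 1 / r n < b" for n
      using N(2) x by (smt (verit))+
  qed
  \<comment> \<open>One step up just after \<open>x1\<close> and one step down just after \<open>x2\<close>, both of width \<open>1 / r n\<close>.\<close>
  define \<phi> where "\<phi> n t = \<Psi> (r n * (t - x1)) - \<Psi> (r n * (t - x2))" for n t
  have d\<phi>: "(\<phi> n has_real_derivative r n * \<psi> (r n * (t - x1)) - r n * \<psi> (r n * (t - x2))) (at t)" for n t
    unfolding \<phi>_def
    by (auto intro!: derivative_eq_intros DERIV_chain2[OF \<Psi>(2)])
  have zero: "\<phi> n t = 0" if "t \<notin> {x1..x2 + 1 / r n}" for n t
  proof (cases "t < x1")
    case True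
    then have "r n * (t - x1) \<le> 0" "r n * (t - x2) \<le> 0"
      using x r(2)[of n] by (auto simp: mult_le_0_iff)
    then show ?thesis by (simp add: \<phi>_def \<Psi>01)
  next
    case False
    then have "x2 + 1 / r n < t" using that by simp
    then have "1 \<le> r n * (t - x2)" using r(2)[of n] by (simp add: field_simps)
    moreover have "r n * (t - x2) \<le> r n * (t - x1)"
      using x r(2)[of n] by (intro mult_left_mono) auto
    ultimately show ?thesis by (simp add: \<phi>_def \<Psi>01)
  qed
  have test: "\<phi> n \<in> test_functions {a<..<b}" for n
  proof -
    have cl: "closure {t. \<phi> n t \<noteq> 0} \<subseteq> {x1..x2 + 1 / r n}"
      using zero[of _ n] by (intro closure_minimal) blast+
    have "compact (closure {t. \<phi> n t \<noteq> 0})"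
      using cl bounded_subset[OF bounded_closed_interval] by (auto simp: compact_eq_bounded_closed)
    moreover have "{x1..x2 + 1 / r n} \<subseteq> {a<..<b}" using x r(3)[of n] by auto
    moreover have "smooth_fun (\<phi> n)"
    proof -
      have "smooth_fun (\<lambda>t. \<Psi> (r n * t + - (r n * x1)) + (-1) * \<Psi> (r n * t + - (r n * x2)))"
        by (intro smooth_fun.add[OF smooth_fun.affine[OF \<Psi>(1)]
              smooth_fun.mult[OF smooth_fun.const smooth_fun.affine[OF \<Psi>(1)]]])
      moreover have "(\<lambda>t. \<Psi> (r n * t + - (r n * x1)) + (-1) * \<Psi> (r n * t + - (r n * x2))) = \<phi> n"
        by (simp add: \<phi>_def fun_eq_iff algebra_simps)
      ultimately show ?thesis by simp
    qed
    ultimately show ?thesis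
      using cl by (auto simp: test_functions_def smooth_fun_imp_smooth_on)
  qed
  have weak: "(LINT t|lebesgue_on {a<..<b}. u t * (r n * \<psi> (r n * (t - x1)) - r n * \<psi> (r n * (t - x2))))
      = - (LINT t|lebesgue_on {a<..<b}. v t * \<phi> n t)" for n
  proof -
    have "\<forall>\<phi>\<in>test_functions {a<..<b}. (LINT x|lebesgue_on {a<..<b}. u x * frechet_derivative \<phi> (at x) 1)
        = - (LINT x|lebesgue_on {a<..<b}. v x * \<phi> x)"
      using uv by (simp add: has_weak_grad_def)
    from bspec[OF this test[of n]] show ?thesis
      by (simp add: frechet_derivative_real[OF d\<phi>])
  qed
  have xs: "x1 \<in> {a<..<b}" "x2 \<in> {a<..<b}" using x by auto
  have \<Psi>e: "\<Psi> 0 = 0" "\<Psi> 1 = 1" using \<Psi>01 by auto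
  have ai1: "integrable (lebesgue_on {a<..<b}) (\<lambda>t. u t * (r n * \<psi> (r n * (t - x1))))"
    "(\<lambda>n. LINT t|lebesgue_on {a<..<b}. u t * (r n * \<psi> (r n * (t - x1)))) \<longlonglongrightarrow> u x1" for n
    using approximate_identity[OF u xs(1) \<Psi>(2) \<Psi>e \<psi>(1,2) _ r(1,2,4)] \<psi>(3) by blast+
  have ai2: "integrable (lebesgue_on {a<..<b}) (\<lambda>t. u t * (r n * \<psi> (r n * (t - x2))))"
    "(\<lambda>n. LINT t|lebesgue_on {a<..<b}. u t * (r n * \<psi> (r n * (t - x2)))) \<longlonglongrightarrow> u x2" for n
    using approximate_identity[OF u xs(2) \<Psi>(2) \<Psi>e \<psi>(1,2) _ r(1,2,3)] \<psi>(3) by blast+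
  have left: "(\<lambda>n. LINT t|lebesgue_on {a<..<b}. u t * (r n * \<psi> (r n * (t - x1)) - r n * \<psi> (r n * (t - x2))))
      \<longlonglongrightarrow> u x1 - u x2"
  proof -
    have "u t * (r n * \<psi> (r n * (t - x1)) - r n * \<psi> (r n * (t - x2)))
        = u t * (r n * \<psi> (r n * (t - x1))) - u t * (r n * \<psi> (r n * (t - x2)))" for n t
      by (rule right_diff_distrib)
    then show ?thesis
      using tendsto_diff[OF ai1(2) ai2(2)]
      by (simp only: Bochner_Integration.integral_diff[OF ai1(1) ai2(1)])
  qed
  have vi: "integrable (lebesgue_on {a<..<b}) v"
    using uv by (auto simp: has_weak_grad_def intro: L2_interval_integrable)
  have vm [measurable]: "v \<in> borel_measurable (lebesgue_on {a<..<b})"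
    using vi by simp
  have right: "(\<lambda>n. LINT t|lebesgue_on {a<..<b}. v t * \<phi> n t)
      \<longlonglongrightarrow> (LINT t|lebesgue_on {a<..<b}. v t * indicator {x1<..x2} t)"
  proof (rule integral_dominated_convergence[where w="\<lambda>t. norm (v t)"])
    have "{x1<..x2} \<in> sets lebesgue" by simp
    then have "indicator {x1<..x2} \<in> borel_measurable (lebesgue_on {a<..<b})"
      by (intro measurable_restrict_space1 borel_measurable_indicator)
    then show "(\<lambda>t. v t * indicator {x1<..x2} t) \<in> borel_measurable (lebesgue_on {a<..<b})"
      by (intro borel_measurable_times vm)
    have "\<phi> n \<in> borel_measurable (lebesgue_on {a<..<b})" for n
      by (intro continuous_imp_measurable_on_sets_lebesgue continuous_at_imp_continuous_on ballI
          DERIV_isCont[OF d\<phi>]) auto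
    then show "(\<lambda>t. v t * \<phi> n t) \<in> borel_measurable (lebesgue_on {a<..<b})" for n
      by (intro borel_measurable_times vm)
    show "integrable (lebesgue_on {a<..<b}) (\<lambda>t. norm (v t))" using vi by simp
    have "\<bar>\<phi> n t\<bar> \<le> 1" for n t
      using \<Psi>01(3,4)[of "r n * (t - x1)"] \<Psi>01(3,4)[of "r n * (t - x2)"] by (auto simp: \<phi>_def)
    then show "AE t in lebesgue_on {a<..<b}. norm (v t * \<phi> n t) \<le> norm (v t)" for n
      by (simp add: abs_mult mult_left_le)
    have step: "(\<lambda>n. \<Psi> (r n * (t - y))) \<longlonglongrightarrow> indicator {y<..} t" for t y
    proof (cases "y < t")
      case True
      then have "eventually (\<lambda>n. r n > 1 / (t - y)) sequentially"
        using r(1) by (simp add: filterlim_at_top_dense)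
      then have "eventually (\<lambda>n. \<Psi> (r n * (t - y)) = 1) sequentially"
        by (rule eventually_mono) (use True in \<open>auto simp: field_simps intro!: \<Psi>01(2)\<close>)
      then show ?thesis using True by (simp add: tendsto_eventually)
    next
      case False
      then have "\<Psi> (r n * (t - y)) = 0" for n
        using r(2)[of n] by (intro \<Psi>01(1)) (auto simp: mult_le_0_iff)
      then show ?thesis using False by simp
    qed
    have "(\<lambda>n. \<phi> n t) \<longlonglongrightarrow> indicator {x1<..} t - indicator {x2<..} t" for t
      unfolding \<phi>_def by (intro tendsto_diff step)
    moreover have "indicator {x1<..} t - indicator {x2<..} t = (indicator {x1<..x2} t :: real)" for t
      using x by (auto simp: indicator_def)
    ultimately have "(\<lambda>n. \<phi> n t) \<longlonglongrightarrow> indicator {x1<..x2} t" for t by simp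
    then show "AE t in lebesgue_on {a<..<b}. (\<lambda>n. v t * \<phi> n t) \<longlonglongrightarrow> v t * indicator {x1<..x2} t"
      by (intro AE_I2 tendsto_mult_left)
  qed
  have "u x1 - u x2 = - (LINT t|lebesgue_on {a<..<b}. v t * indicator {x1<..x2} t)"
    using LIMSEQ_unique[OF left[unfolded weak] tendsto_minus[OF right]] .
  then show ?thesis by simp
qed

text \<open>The measures with densities \<open>z\<^sup>+\<close> and \<open>z\<^sup>-\<close> are finite and agree on all rays, hence are equal,
  and densities are unique almost everywhere. A Borel version of \<open>z\<close> is used since rays generate
  the Borel sets and not the Lebesgue sets.\<close>

lemma AE_zero_if_ray_integrals_zero:
  fixes z :: "real \<Rightarrow> real"
  assumes z: "integrable lebesgue z"
    and zero: "\<And>x. (LINT t|lebesgue. z t * indicator {x<..} t) = 0"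
  shows "AE t in lebesgue. z t = 0"
proof -
  obtain g where g [measurable]: "g \<in> borel_measurable lborel" and zg: "AE t in lborel. z t = g t"
    using completion_ex_borel_measurable_real[of z lborel] z by auto
  have zg': "AE t in lebesgue. z t = g t" using zg by (rule AE_completion)
  have zm: "z \<in> borel_measurable lebesgue" using z by simp
  have gm: "g \<in> borel_measurable lebesgue" using g by (rule measurable_completion)
  have gi: "integrable lborel g"
    using z integrable_cong_AE[OF zm gm zg'] integrable_completion[OF g] by simp
  have ray: "(LINT t|lborel. g t * indicator {x<..} t) = 0" for x
  proof -
    have "(LINT t|lborel. g t * indicator {x<..} t) = (LINT t|lebesgue. g t * indicator {x<..} t)"
      by (rule integral_completion[symmetric]) measurable
    also have "\<dots> = (LINT t|lebesgue. z t * indicator {x<..} t)"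
    proof (rule integral_cong_AE)
      show "AE t in lebesgue. g t * indicator {x<..} t = z t * indicator {x<..} t"
        using zg' by eventually_elim simp
      have "indicator {x<..} \<in> borel_measurable lebesgue"
        by (rule borel_measurable_indicator) simp
      then show "(\<lambda>t. g t * indicator {x<..} t) \<in> borel_measurable lebesgue"
        "(\<lambda>t. z t * indicator {x<..} t) \<in> borel_measurable lebesgue"
        by (intro borel_measurable_times zm gm; assumption)+
    qed
    finally show ?thesis using zero by simp
  qed
  let ?M = "density lborel (\<lambda>t. ennreal (g t))" and ?N = "density lborel (\<lambda>t. ennreal (- g t))"
  have "?M = ?N"
  proof (rule measure_eqI_lessThan)
    fix x :: real
    let ?g = "\<lambda>t. g t * indicator {x<..} t"
    have gx: "integrable lborel ?g"
      using integrable_mult_indicator[OF _ gi, of "{x<..}"] by (simp add: mult.commute)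
    have M: "emeasure ?M {x<..} = (\<integral>\<^sup>+ t. ennreal (?g t) \<partial>lborel)"
      by (subst emeasure_density) (auto intro!: nn_integral_cong simp: indicator_def)
    have N: "emeasure ?N {x<..} = (\<integral>\<^sup>+ t. ennreal (- ?g t) \<partial>lborel)"
      by (subst emeasure_density) (auto intro!: nn_integral_cong simp: indicator_def)
    have fin: "(\<integral>\<^sup>+ t. ennreal (?g t) \<partial>lborel) \<noteq> \<infinity>" "(\<integral>\<^sup>+ t. ennreal (- ?g t) \<partial>lborel) \<noteq> \<infinity>"
      using gx by (auto simp: real_integrable_def)
    then show "emeasure ?M {x<..} < \<infinity>" by (auto simp: M less_top[symmetric])
    have "enn2real (\<integral>\<^sup>+ t. ennreal (?g t) \<partial>lborel) = enn2real (\<integral>\<^sup>+ t. ennreal (- ?g t) \<partial>lborel)"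
      using ray[of x] real_lebesgue_integral_def[OF gx] by simp
    with fin show "emeasure ?M {x<..} = emeasure ?N {x<..}"
      unfolding M N
      by (cases rule: ennreal2_cases[of "\<integral>\<^sup>+ t. ennreal (?g t) \<partial>lborel" "\<integral>\<^sup>+ t. ennreal (- ?g t) \<partial>lborel"]) auto
  qed simp_all
  then have "AE t in lborel. ennreal (g t) = ennreal (- g t)"
    by (intro sigma_finite_measure.density_unique[OF sigma_finite_lborel]) auto
  then have "AE t in lborel. g t = 0"
  proof (rule eventually_mono)
    fix t assume "ennreal (g t) = ennreal (- g t)"
    then show "g t = 0"
      by (cases "0 \<le> g t") (simp_all add: ennreal_neg ennreal_eq_0_iff)
  qed
  then have "AE t in lebesgue. g t = 0" by (rule AE_completion)
  with zg' show ?thesis by eventually_elim simp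
qed

text \<open>Two weak derivatives of \<open>u\<close> have the same integral over every \<open>(s, t]\<close> with closure inside
  \<open>(a, b)\<close>, hence agree almost everywhere on \<open>(s, t]\<close>; rational \<open>s\<close> and \<open>t\<close> suffice to
  exhaust \<open>(a, b)\<close>.\<close>

lemma weak_derivative_unique:
  fixes u v1 v2 :: "real \<Rightarrow> real"
  assumes v1: "has_weak_grad {a<..<b} u v1" and v2: "has_weak_grad {a<..<b} u v2"
    and u: "continuous_on {a<..<b} u"
  shows "AE t in lebesgue_on {a<..<b}. v1 t = v2 t"
proof -
  have i: "integrable (lebesgue_on {a<..<b}) v1" "integrable (lebesgue_on {a<..<b}) v2"
    using v1 v2 by (auto simp: has_weak_grad_def intro: L2_interval_integrable)
  have ind: "indicator {s<..t} \<in> borel_measurable (lebesgue_on {a<..<b})" for s t :: real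
    by (intro measurable_restrict_space1 borel_measurable_indicator) simp
  have int: "integrable (lebesgue_on {a<..<b}) (\<lambda>x. v x * indicator {s<..t} x)"
    if v: "integrable (lebesgue_on {a<..<b}) v" for v :: "real \<Rightarrow> real" and s t
  proof (rule Bochner_Integration.integrable_bound[OF v])
    show "(\<lambda>x. v x * indicator {s<..t} x) \<in> borel_measurable (lebesgue_on {a<..<b})"
      using v ind by (intro borel_measurable_times) auto
  qed (auto simp: indicator_def)
  have local: "AE y in lebesgue. y \<in> {s<..t} \<longrightarrow> v1 y = v2 y" if st: "a < s" "t < b" for s t
  proof -
    let ?z = "\<lambda>y. (v1 y - v2 y) * indicator {s<..t} y"
    have eq: "indicator {a<..<b} y *\<^sub>R ?z y = ?z y" for y
      using st by (auto simp: indicator_def)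
    have "integrable (lebesgue_on {a<..<b}) ?z"
      by (intro int Bochner_Integration.integrable_diff i)
    then have zi: "integrable lebesgue ?z"
      by (simp add: integrable_restrict_space eq del: real_scaleR_def)
    have "AE y in lebesgue. ?z y = 0"
    proof (rule AE_zero_if_ray_integrals_zero[OF zi])
      fix x
      have eqx: "?z y * indicator {x<..} y = indicator {a<..<b} y *\<^sub>R ((v1 y - v2 y) * indicator {max s x<..t} y)" for y
        using st by (auto simp: indicator_def)
      have "(LINT y|lebesgue. ?z y * indicator {x<..} y)
          = (LINT y|lebesgue_on {a<..<b}. (v1 y - v2 y) * indicator {max s x<..t} y)"
        unfolding eqx by (simp add: integral_restrict_space del: real_scaleR_def)
      also have "\<dots> = (LINT y|lebesgue_on {a<..<b}. v1 y * indicator {max s x<..t} y)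
          - (LINT y|lebesgue_on {a<..<b}. v2 y * indicator {max s x<..t} y)"
        by (simp add: left_diff_distrib Bochner_Integration.integral_diff[OF int int] i)
      also have "\<dots> = 0"
      proof (cases "max s x < t")
        case True
        then show ?thesis
          using st weak_derivative_FTC[OF v1 u, of "max s x" t] weak_derivative_FTC[OF v2 u, of "max s x" t]
          by simp
      next
        case False
        then have "indicator {max s x<..t} y = (0 :: real)" for y by (auto simp: indicator_def)
        then show ?thesis by simp
      qed
      finally show "(LINT y|lebesgue. ?z y * indicator {x<..} y) = 0" .
    qed
    then show ?thesis by (rule eventually_mono) (auto simp: indicator_def)
  qed
  have "AE y in lebesgue. \<forall>s\<in>\<rat>. \<forall>t\<in>\<rat>. a < s \<and> t < b \<longrightarrow> y \<in> {s<..t} \<longrightarrow> v1 y = v2 y"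
    using local by (auto simp: AE_ball_countable countable_rat)
  then have "AE y in lebesgue. y \<in> {a<..<b} \<longrightarrow> v1 y = v2 y"
  proof (rule eventually_mono, intro impI)
    fix y assume y: "\<forall>s\<in>\<rat>. \<forall>t\<in>\<rat>. a < s \<and> t < b \<longrightarrow> y \<in> {s<..t} \<longrightarrow> v1 y = v2 y" "y \<in> {a<..<b}"
    obtain s t where "s \<in> \<rat>" "a < s" "s < y" "t \<in> \<rat>" "y < t" "t < b"
      using y(2) Rats_dense_in_real[of a y] Rats_dense_in_real[of y b] by auto
    then show "v1 y = v2 y" using y(1) by force
  qed
  then show ?thesis by (simp add: AE_restrict_space_iff)
qed

text \<open>Where the weak derivative has a continuous representative, the increments of \<open>u\<close> are integrals
  of a continuous function.\<close>

lemma weak_derivative_classical: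
  fixes u v g :: "real \<Rightarrow> real"
  assumes uv: "has_weak_grad {a<..<b} u v" and u: "continuous_on {a<..<b} u"
    and sub: "{\<alpha><..<\<beta>} \<subseteq> {a<..<b}" and g: "continuous_on {\<alpha><..<\<beta>} g"
    and vg: "AE t in lebesgue_on {a<..<b}. t \<in> {\<alpha><..<\<beta>} \<longrightarrow> v t = g t"
    and y: "y \<in> {\<alpha><..<\<beta>}"
  shows "(u has_real_derivative g y) (at y)"
proof -
  obtain s t where st: "\<alpha> < s" "s < y" "y < t" "t < \<beta>"
    using y dense[of \<alpha> y] dense[of y \<beta>] by auto
  have "s \<in> {\<alpha><..<\<beta>}" "t \<in> {\<alpha><..<\<beta>}" using st by auto
  then have ab: "a < s" "t < b" using sub by auto
  have vm: "v \<in> borel_measurable (lebesgue_on {a<..<b})"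
    using uv by (auto simp: has_weak_grad_def L2_def)
  have gst: "continuous_on {s..x} g" if "x \<le> t" for x
    by (rule continuous_on_subset[OF g]) (use st that in auto)
  have FTC: "u x = u s + integral {s..x} g" if x: "s < x" "x \<le> t" for x
  proof -
    let ?g = "\<lambda>\<tau>. if \<tau> \<in> {s..x} then g \<tau> else 0"
    have c: "continuous_on {s..x} ?g"
      by (rule continuous_on_eq[OF gst[OF x(2)]]) simp
    have sx: "{s..x} \<subseteq> {a<..<b}" using ab x by auto
    have zero: "?g \<tau> = 0" if "\<tau> \<notin> {s..x}" for \<tau>
      using that by (rule if_not_P)
    have gi: "integrable (lebesgue_on {a<..<b}) ?g"
      "integral\<^sup>L (lebesgue_on {a<..<b}) ?g = integral {s..x} ?g"
      using lebesgue_on_concentrated[OF sx c] zero by blast+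
    have "AE \<tau> in lebesgue. \<tau> \<noteq> s"
      by (intro AE_completion AE_lborel_singleton)
    then have ns: "AE \<tau> in lebesgue_on {a<..<b}. \<tau> \<noteq> s"
      by (auto simp: AE_restrict_space_iff)
    have "u x - u s = (LINT \<tau>|lebesgue_on {a<..<b}. v \<tau> * indicator {s<..x} \<tau>)"
      using weak_derivative_FTC[OF uv u, of s x] ab x by simp
    also have "\<dots> = (LINT \<tau>|lebesgue_on {a<..<b}. ?g \<tau>)"
    proof (rule integral_cong_AE)
      show "(\<lambda>\<tau>. v \<tau> * indicator {s<..x} \<tau>) \<in> borel_measurable (lebesgue_on {a<..<b})"
        by (intro borel_measurable_times vm measurable_restrict_space1 borel_measurable_indicator) simp
      show "?g \<in> borel_measurable (lebesgue_on {a<..<b})" using gi(1) by simp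
      show "AE \<tau> in lebesgue_on {a<..<b}. v \<tau> * indicator {s<..x} \<tau> = ?g \<tau>"
        using vg ns by eventually_elim (use st x in \<open>auto simp: indicator_def\<close>)
    qed
    also have "\<dots> = integral {s..x} g"
      unfolding gi(2) by (rule integral_cong) simp
    finally show ?thesis by simp
  qed
  have "((\<lambda>x. integral {s..x} g) has_real_derivative g y) (at y within {s..t})"
    by (rule integral_has_real_derivative[OF gst]) (use st in auto)
  then have "((\<lambda>x. integral {s..x} g) has_real_derivative g y) (at y)"
    using st at_within_Icc_at[of s y t] by simp
  then have "((\<lambda>x. u s + integral {s..x} g) has_real_derivative g y) (at y)"
    by (auto intro!: derivative_eq_intros)
  then show ?thesis
    by (rule has_field_derivative_transform_within_open[where S="{s<..<t}"])
       (use FTC st in auto)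
qed

section \<open>Eigenfunctions inside the layers\<close>

text \<open>The domain condition of the operator and the normalization each come with a weak derivative of
  \<open>u\<close>. By uniqueness the two agree, so the flux in the eigenvalue equation is \<open>p\<close>, and
  on a layer both \<open>u\<close> and \<open>p\<close> have continuous weak derivatives.\<close>

lemma eigenfunction_layer_equations:
  assumes nf: "normalized_eigenfunction H c m l u p"
    and sub: "{\<alpha><..<\<beta>} \<subseteq> {0<..<H}" and c: "\<And>y. y \<in> {\<alpha><..<\<beta>} \<Longrightarrow> c y = q" and q: "q \<noteq> 0"
    and y: "y \<in> {\<alpha><..<\<beta>}"
  shows "(u has_real_derivative p y / q) (at y)"
    and "(p has_real_derivative (q * m\<^sup>2 - l) * u y) (at y)"
proof -
  have cont: "continuous_on {0<..<H} u" "continuous_on {0<..<H} p"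
    using nf by (auto simp: normalized_eigenfunction_def intro: continuous_on_subset[of "{0..H}"])
  obtain v1 where v1: "has_weak_grad {0<..<H} u v1" "AE y in lebesgue_on {0<..<H}. p y = c y * v1 y"
    using nf by (auto simp: normalized_eigenfunction_def)
  obtain v w where v: "has_weak_grad {0<..<H} u v" and w: "has_weak_grad {0<..<H} (\<lambda>y. c y * v y) w"
    and A: "AE y in lebesgue_on {0<..<H}. l * u y = c y * m\<^sup>2 * u y - w y"
    using nf by (auto simp: normalized_eigenfunction_def A_op_def)
  note uniq = weak_derivative_unique[OF v v1(1) cont(1)]
  have pcv: "AE y in lebesgue_on {0<..<H}. c y * v y = p y"
    using v1(2) uniq by eventually_elim simp
  show "(u has_real_derivative p y / q) (at y)"
  proof (rule weak_derivative_classical[OF v1(1) cont(1) sub _ _ y])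
    show "continuous_on {\<alpha><..<\<beta>} (\<lambda>y. p y / q)"
      using q by (intro continuous_intros continuous_on_subset[OF cont(2) sub]) auto
    show "AE t in lebesgue_on {0<..<H}. t \<in> {\<alpha><..<\<beta>} \<longrightarrow> v1 t = p t / q"
      using v1(2) by eventually_elim (use c q in auto)
  qed
  have pL: "p \<in> borel_measurable (lebesgue_on {0<..<H})"
    by (rule continuous_imp_measurable_on_sets_lebesgue[OF cont(2)]) simp
  \<comment> \<open>The weak equation for \<open>c v\<close> passes to its continuous representative \<open>p\<close>.\<close>
  have "has_weak_grad {0<..<H} p w"
    unfolding has_weak_grad_def
  proof (intro conjI ballI)
    have cvL: "(\<lambda>y. c y * v y) \<in> L2 {0<..<H}" using w by (simp add: has_weak_grad_def)
    then have cvm: "(\<lambda>y. c y * v y) \<in> borel_measurable (lebesgue_on {0<..<H})" by (simp add: L2_def)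
    have "integrable (lebesgue_on {0<..<H}) (\<lambda>x. (norm (p x))\<^sup>2)
        \<longleftrightarrow> integrable (lebesgue_on {0<..<H}) (\<lambda>x. (norm (c x * v x))\<^sup>2)"
    proof (rule integrable_cong_AE)
      show "AE x in lebesgue_on {0<..<H}. (norm (p x))\<^sup>2 = (norm (c x * v x))\<^sup>2"
        using pcv by eventually_elim simp
    qed (use pL cvm in measurable)
    then show "p \<in> L2 {0<..<H}" using cvL pL by (simp add: L2_def)
    show "w \<in> L2 {0<..<H}" using w by (simp add: has_weak_grad_def)
    fix \<phi> :: "real \<Rightarrow> real" and b :: real
    assume \<phi>: "\<phi> \<in> test_functions {0<..<H}" and b: "b \<in> Basis"
    have "Ck_on 1 \<phi> UNIV" using \<phi> by (simp add: test_functions_def smooth_on_def)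
    then have "continuous_on {0<..<H} (\<lambda>x. frechet_derivative \<phi> (at x) b)"
      using b by (auto intro: continuous_on_subset)
    then have dm: "(\<lambda>x. frechet_derivative \<phi> (at x) b) \<in> borel_measurable (lebesgue_on {0<..<H})"
      by (rule continuous_imp_measurable_on_sets_lebesgue) simp
    have "(LINT x|lebesgue_on {0<..<H}. p x * frechet_derivative \<phi> (at x) b)
        = (LINT x|lebesgue_on {0<..<H}. c x * v x * frechet_derivative \<phi> (at x) b)"
    proof (rule integral_cong_AE)
      show "AE x in lebesgue_on {0<..<H}. p x * frechet_derivative \<phi> (at x) b
          = c x * v x * frechet_derivative \<phi> (at x) b"
        using pcv by eventually_elim simp
    qed (intro borel_measurable_times pL cvm dm)+
    then show "(LINT x|lebesgue_on {0<..<H}. p x * frechet_derivative \<phi> (at x) b)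
        = - (LINT x|lebesgue_on {0<..<H}. w x \<bullet> b * \<phi> x)"
      using w \<phi> b by (simp add: has_weak_grad_def)
  qed
  then show "(p has_real_derivative (q * m\<^sup>2 - l) * u y) (at y)"
  proof (rule weak_derivative_classical[OF _ cont(2) sub _ _ y])
    show "continuous_on {\<alpha><..<\<beta>} (\<lambda>y. (q * m\<^sup>2 - l) * u y)"
      by (intro continuous_intros continuous_on_subset[OF cont(1) sub])
    show "AE t in lebesgue_on {0<..<H}. t \<in> {\<alpha><..<\<beta>} \<longrightarrow> w t = (q * m\<^sup>2 - l) * u t"
      using A by eventually_elim (use c in \<open>auto simp: algebra_simps\<close>)
  qed
qed

section \<open>Energy estimates\<close>

lemma partition_points_mono:
  fixes h :: "nat \<Rightarrow> real"
  assumes "\<And>i. i \<le> N \<Longrightarrow> h i < h (Suc i)" and "i \<le> j" "j \<le> Suc N"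
  shows "h i \<le> h j"
  using assms(2,3)
proof (induction j rule: dec_induct)
  case (step n)
  then show ?case using assms(1)[of n] by simp
qed simp

text \<open>Here \<open>m\<close> stands for \<open>\<mu>\<^sub>k\<close> and \<open>l\<close> for \<open>\<lambda>\<close>. The equation is required in the classical sense and
  inside the layers only; the transmission conditions at the interfaces are the continuity of
  \<open>u\<close> and of the flux \<open>p\<close>.\<close>

locale layered_solution =
  fixes H :: real and N :: nat and h q :: "nat \<Rightarrow> real" and cm cM \<epsilon> m l :: real and u p :: "real \<Rightarrow> real"
  assumes h_first: "h 0 = 0" and h_last: "h (Suc N) = H"
    and h_step: "\<And>i. i \<le> N \<Longrightarrow> h i < h (Suc i)"
    and q_lower: "\<And>i. i \<le> N \<Longrightarrow> cm \<le> q i" and q_upper: "\<And>i. i \<le> N \<Longrightarrow> q i \<le> cM"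
    and cm_pos: "0 < cm" and eps_pos: "0 < \<epsilon>" and m_pos: "0 < m"
    and l_large: "(cM + \<epsilon>) * m\<^sup>2 \<le> l"
    and u_cont: "continuous_on {0..H} u" and p_cont: "continuous_on {0..H} p"
    and u_deriv: "\<And>i y. i \<le> N \<Longrightarrow> y \<in> {h i<..<h (Suc i)} \<Longrightarrow> (u has_real_derivative p y / q i) (at y)"
    and p_deriv: "\<And>i y. i \<le> N \<Longrightarrow> y \<in> {h i<..<h (Suc i)} \<Longrightarrow>
      (p has_real_derivative (q i * m\<^sup>2 - l) * u y) (at y)"
    and u_norm: "((\<lambda>y. (u y)\<^sup>2) has_integral 1) {0..H}"
begin

text \<open>On layer \<open>i\<close> the equation reads \<open>q\<^sub>i u'' + (l - q\<^sub>i m\<^sup>2) u = 0\<close>, and \<open>E i\<close> is its conserved energy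
  \<open>(l - q\<^sub>i m\<^sup>2) u\<^sup>2 + q\<^sub>i u'\<^sup>2\<close>, written in the quantities \<open>u\<close> and \<open>p\<close> that are continuous across
  interfaces.\<close>

definition E :: "nat \<Rightarrow> real \<Rightarrow> real" where
  "E i y = (l - q i * m\<^sup>2) * (u y)\<^sup>2 + (p y)\<^sup>2 / q i"

text \<open>A jump of size \<open>J\<close> of the coefficient changes the energy by a factor of at most \<open>1 + K J\<close> in
  either direction: \<open>1/\<epsilon>\<close> comes from the potential part and \<open>1/cm\<close> from the kinetic part.\<close>

definition K :: real where "K = 1 / \<epsilon> + 1 / cm"

text \<open>A uniform lower bound for \<open>(l - q\<^sub>i m\<^sup>2) / l\<close>, the square of the wave number in layer \<open>i\<close>
  relative to \<open>l / q\<^sub>i\<close>.\<close>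

definition \<delta> :: real where "\<delta> = \<epsilon> / (cM + \<epsilon>)"

text \<open>An upper bound for the ratio of the energies of any two layers.\<close>

definition F :: real where "F = exp (K * total_variation N q)"

lemma q_pos: "i \<le> N \<Longrightarrow> 0 < q i"
  using q_lower cm_pos by fastforce

lemma cM_pos: "0 < cM"
  using q_pos[of 0] q_upper[of 0] by simp

lemma l_pos: "0 < l"
  using l_large m_pos cM_pos eps_pos
  by (meson add_pos_pos less_le_trans mult_pos_pos zero_less_power)

lemma \<delta>_pos: "0 < \<delta>"
  using eps_pos cM_pos by (simp add: \<delta>_def)

lemma K_pos: "0 < K"
  using eps_pos cm_pos by (simp add: K_def add_pos_pos)

lemma F_pos: "0 < F" by (simp add: F_def)

lemma spectral_gap:
  assumes "i \<le> N"
  shows "\<epsilon> * m\<^sup>2 \<le> l - q i * m\<^sup>2" "\<delta> * l \<le> l - q i * m\<^sup>2"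
proof -
  have q: "q i * m\<^sup>2 \<le> cM * m\<^sup>2"
    using q_upper[OF assms] by (intro mult_right_mono) auto
  then show "\<epsilon> * m\<^sup>2 \<le> l - q i * m\<^sup>2"
    using l_large by (simp add: distrib_right)
  have "cM * m\<^sup>2 \<le> cM * (l / (cM + \<epsilon>))"
    using l_large cM_pos eps_pos by (intro mult_left_mono) (auto simp: field_simps)
  also have "\<dots> = l - \<delta> * l"
    using cM_pos eps_pos by (simp add: \<delta>_def field_simps)
  finally show "\<delta> * l \<le> l - q i * m\<^sup>2" using q by simp
qed

lemma gap_pos: "i \<le> N \<Longrightarrow> 0 < l - q i * m\<^sup>2"
  using spectral_gap(2) \<delta>_pos l_pos by (meson less_le_trans mult_pos_pos)

lemma E_nonneg: "i \<le> N \<Longrightarrow> 0 \<le> E i y"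
  using gap_pos q_pos unfolding E_def
  by (meson add_nonneg_nonneg divide_nonneg_pos less_imp_le mult_nonneg_nonneg zero_le_power2)

lemma layer_subset: "i \<le> N \<Longrightarrow> {h i..h (Suc i)} \<subseteq> {0..H}"
  using partition_points_mono[of N h 0 i] partition_points_mono[of N h "Suc i" "Suc N"]
    h_step h_first h_last by auto

lemma in_layer:
  assumes "y \<in> {0..H}"
  obtains i where "i \<le> N" "y \<in> {h i..h (Suc i)}"
proof -
  have "n \<le> N \<Longrightarrow> y \<in> {0..h (Suc n)} \<Longrightarrow> \<exists>i\<le>N. y \<in> {h i..h (Suc i)}" for n
  proof (induction n)
    case 0
    then show ?case using h_first by auto
  next
    case (Suc n)
    then show ?case by (cases "y \<le> h (Suc n)") auto
  qed
  from this[of N] assms h_last that show thesis by auto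
qed

lemma E_constant_on_layer:
  assumes i: "i \<le> N" and y: "y \<in> {h i..h (Suc i)}"
  shows "E i y = E i (h i)"
proof (rule DERIV_isconst2[where f = "E i" and b = "h (Suc i)"])
  show "h i < h (Suc i)" by (rule h_step[OF i])
  show "continuous_on {h i..h (Suc i)} (E i)"
    unfolding E_def using q_pos[OF i]
    by (intro continuous_intros continuous_on_subset[OF u_cont layer_subset[OF i]]
        continuous_on_subset[OF p_cont layer_subset[OF i]]) auto
  show "h i \<le> y" "y \<le> h (Suc i)" using y by auto
  fix x assume "h i < x" "x < h (Suc i)"
  then have x: "x \<in> {h i<..<h (Suc i)}" by simp
  show "(E i has_real_derivative 0) (at x)"
    unfolding E_def using q_pos[OF i]
    by (auto intro!: derivative_eq_intros u_deriv[OF i x] p_deriv[OF i x] simp: field_simps)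
qed

text \<open>Passing from coefficient \<open>q i\<close> to \<open>q j\<close> at a fixed point multiplies both summands of the energy
  by at most \<open>1 + K \<bar>q j - q i\<bar>\<close>: the first because the gap \<open>l - q i m\<^sup>2\<close> is at least \<open>\<epsilon> m\<^sup>2\<close>,
  the second because \<open>q j \<ge> cm\<close>. The exponential form makes these factors add up to a total
  variation.\<close>

lemma E_change_of_coefficient:
  assumes i: "i \<le> N" and j: "j \<le> N"
  shows "E j y \<le> exp (K * \<bar>q j - q i\<bar>) * E i y"
proof -
  let ?d = "\<bar>q j - q i\<bar>"
  have "l - q j * m\<^sup>2 \<le> (1 + K * ?d) * (l - q i * m\<^sup>2)"
  proof -
    have "l - q j * m\<^sup>2 = (l - q i * m\<^sup>2) + (q i - q j) * m\<^sup>2" by (simp add: algebra_simps)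
    also have "(q i - q j) * m\<^sup>2 \<le> ?d * m\<^sup>2" by (intro mult_right_mono) auto
    also have "?d * m\<^sup>2 = ?d / \<epsilon> * (\<epsilon> * m\<^sup>2)" using eps_pos by simp
    also have "\<dots> \<le> ?d / \<epsilon> * (l - q i * m\<^sup>2)"
      using spectral_gap(1)[OF i] eps_pos by (intro mult_left_mono) auto
    also have "\<dots> \<le> K * ?d * (l - q i * m\<^sup>2)"
      using gap_pos[OF i] cm_pos by (intro mult_right_mono) (auto simp: K_def distrib_right)
    finally show ?thesis by (simp add: distrib_right)
  qed
  moreover have "1 / q j \<le> (1 + K * ?d) * (1 / q i)"
  proof -
    have "1 / q j = (1 + (q i - q j) / q j) * (1 / q i)"
      using q_pos[OF i] q_pos[OF j] by (simp add: field_simps)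
    also have "\<dots> \<le> (1 + K * ?d) * (1 / q i)"
    proof (intro mult_right_mono add_left_mono)
      have "(q i - q j) / q j \<le> ?d / cm"
        using q_pos[OF j] q_lower[OF j] cm_pos by (intro frac_le) auto
      also have "\<dots> \<le> K * ?d" using eps_pos by (simp add: K_def distrib_right)
      finally show "(q i - q j) / q j \<le> K * ?d" .
    qed (use q_pos[OF i] in simp)
    finally show ?thesis .
  qed
  ultimately have "E j y \<le> (1 + K * ?d) * (l - q i * m\<^sup>2) * (u y)\<^sup>2 + (1 + K * ?d) * (1 / q i) * (p y)\<^sup>2"
    unfolding E_def
    by (intro add_mono mult_right_mono) (auto dest: mult_right_mono[where c="(p y)\<^sup>2"])
  also have "\<dots> = (1 + K * ?d) * E i y" by (simp add: E_def algebra_simps)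
  also have "\<dots> \<le> exp (K * ?d) * E i y"
    by (intro mult_right_mono exp_ge_add_one_self E_nonneg i)
  finally show ?thesis .
qed

lemma total_variation_mono: "i \<le> j \<Longrightarrow> total_variation i q \<le> total_variation j q"
  unfolding total_variation_def by (rule sum_mono2) auto

text \<open>Energies are compared at the left end points of the layers. The factors collected at the
  interfaces in between multiply to the exponential of a sum of jumps, so the number of
  interfaces does not enter.\<close>

lemma layer_energies_comparable_ordered:
  assumes "i \<le> j" "j \<le> N"
  shows "E j (h j) \<le> exp (K * (total_variation j q - total_variation i q)) * E i (h i) \<and>
         E i (h i) \<le> exp (K * (total_variation j q - total_variation i q)) * E j (h j)"
  using assms
proof (induction j rule: dec_induct)
  case (step n)
  let ?s = "K * (total_variation n q - total_variation i q)" and ?t = "K * \<bar>q (Suc n) - q n\<bar>"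
  have s: "K * (total_variation (Suc n) q - total_variation i q) = ?s + ?t"
    by (simp add: total_variation_def algebra_simps)
  have c: "E n (h (Suc n)) = E n (h n)"
    using step by (intro E_constant_on_layer) (auto intro: less_imp_le[OF h_step])
  have 1: "E (Suc n) (h (Suc n)) \<le> exp ?t * E n (h n)"
    using E_change_of_coefficient[of n "Suc n" "h (Suc n)"] step c by simp
  have 2: "E n (h n) \<le> exp ?t * E (Suc n) (h (Suc n))"
    using E_change_of_coefficient[of "Suc n" n "h (Suc n)"] step c by (simp add: abs_minus_commute)
  have IH: "E n (h n) \<le> exp ?s * E i (h i)" "E i (h i) \<le> exp ?s * E n (h n)"
    using step by auto
  have "exp ?t * E n (h n) \<le> exp ?t * (exp ?s * E i (h i))"
    "exp ?s * E n (h n) \<le> exp ?s * (exp ?t * E (Suc n) (h (Suc n)))"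
    using IH 2 by auto
  with 1 IH have "E (Suc n) (h (Suc n)) \<le> exp ?t * (exp ?s * E i (h i))"
    "E i (h i) \<le> exp ?s * (exp ?t * E (Suc n) (h (Suc n)))"
    by linarith+
  then show ?case unfolding s by (simp add: exp_add mult_ac)
qed simp

lemma layer_energies_comparable:
  assumes i: "i \<le> N" and j: "j \<le> N"
  shows "E i (h i) \<le> F * E j (h j)"
proof -
  have "E i' (h i') \<le> F * E j' (h j') \<and> E j' (h j') \<le> F * E i' (h i')"
    if ij: "i' \<le> j'" "j' \<le> N" for i' j'
  proof -
    let ?g = "exp (K * (total_variation j' q - total_variation i' q))"
    have "0 \<le> total_variation i' q" by (simp add: total_variation_def sum_nonneg)
    then have "?g \<le> F"
      using K_pos total_variation_mono[OF ij(2)] by (simp add: F_def)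
    then have "?g * E i' (h i') \<le> F * E i' (h i')" "?g * E j' (h j') \<le> F * E j' (h j')"
      using ij by (auto intro!: mult_right_mono E_nonneg)
    then show ?thesis using layer_energies_comparable_ordered[OF ij] by linarith
  qed
  then show ?thesis using i j by (cases "i \<le> j") auto
qed

text \<open>A small energy in one layer would be small in all of them, and then \<open>u\<^sup>2 \<le> E / (\<delta> l)\<close> could not
  integrate to one.\<close>

lemma energy_lower_bound:
  assumes j: "j \<le> N" and H: "0 < H"
  shows "\<delta> * l / (F * H) \<le> E j (h j)"
proof -
  let ?B = "F * E j (h j) / (\<delta> * l)"
  have dl: "0 < \<delta> * l" using \<delta>_pos l_pos by simp
  have "(u y)\<^sup>2 \<le> ?B" if y: "y \<in> {0..H}" for y
  proof -
    obtain i where i: "i \<le> N" "y \<in> {h i..h (Suc i)}" using in_layer[OF y] .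
    have "\<delta> * l * (u y)\<^sup>2 \<le> (l - q i * m\<^sup>2) * (u y)\<^sup>2"
      by (intro mult_right_mono spectral_gap(2) i) simp
    also have "\<dots> \<le> E i y" using q_pos[OF i(1)] by (simp add: E_def)
    also have "\<dots> \<le> F * E j (h j)"
      using E_constant_on_layer[OF i] layer_energies_comparable[OF i(1) j] by simp
    finally show ?thesis using dl by (simp add: field_simps)
  qed
  then have "1 \<le> ?B * (H - 0)"
    using has_integral_le[OF u_norm, of "\<lambda>_. ?B" "?B * (H - 0)"] has_integral_const_real[of ?B 0 H] H
    by (simp add: mult.commute)
  then show ?thesis using dl F_pos H by (simp add: field_simps)
qed

lemma amplitude_lower_bound:
  assumes y: "y \<in> {0..H}" and H: "0 < H"
  shows "\<delta> / (F * H) \<le> (u y)\<^sup>2 + (p y)\<^sup>2 / (l * cm)"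
proof -
  obtain i where i: "i \<le> N" "y \<in> {h i..h (Suc i)}" using in_layer[OF y] .
  have "\<delta> * l / (F * H) \<le> E i y"
    using energy_lower_bound[OF i(1) H] E_constant_on_layer[OF i] by simp
  also have "\<dots> \<le> l * (u y)\<^sup>2 + (p y)\<^sup>2 / cm"
    unfolding E_def
    using q_pos[OF i(1)] q_lower[OF i(1)] cm_pos
    by (intro add_mono mult_right_mono divide_left_mono) auto
  finally have "(\<delta> * l / (F * H)) / l \<le> (l * (u y)\<^sup>2 + (p y)\<^sup>2 / cm) / l"
    using l_pos by (intro divide_right_mono) auto
  then show ?thesis using l_pos by (simp add: add_divide_distrib mult.commute)
qed

text \<open>Young's inequality with the two parts of the energy as its squares; the factor \<open>1 / sqrt l\<close>
  is what makes the boundary terms negligible for large \<open>l\<close>.\<close>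

lemma flux_bound:
  assumes y: "y \<in> {0..H}"
  shows "\<bar>u y * p y\<bar> \<le> F * E 0 (h 0) * sqrt cM / (2 * sqrt (\<delta> * l))"
proof -
  let ?s = "sqrt (\<delta> * l)" and ?r = "sqrt cM"
  obtain i where i: "i \<le> N" "y \<in> {h i..h (Suc i)}" using in_layer[OF y] .
  have s: "0 < ?s" "?s\<^sup>2 = \<delta> * l" using \<delta>_pos l_pos by auto
  have r: "0 < ?r" "?r\<^sup>2 = cM" using cM_pos by auto
  have "2 * (?s * \<bar>u y\<bar>) * (\<bar>p y\<bar> / ?r) \<le> (?s * \<bar>u y\<bar>)\<^sup>2 + (\<bar>p y\<bar> / ?r)\<^sup>2"
    by (rule sum_squares_bound)
  also have "\<dots> = \<delta> * l * (u y)\<^sup>2 + (p y)\<^sup>2 / cM"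
    using s r by (simp add: power_mult_distrib power_divide)
  also have "\<dots> \<le> E i y"
    unfolding E_def using spectral_gap(2)[OF i(1)] q_pos[OF i(1)] q_upper[OF i(1)]
    by (intro add_mono mult_right_mono divide_left_mono) auto
  also have "\<dots> \<le> F * E 0 (h 0)"
    using E_constant_on_layer[OF i] layer_energies_comparable[OF i(1), of 0] by simp
  finally show ?thesis using s(1) r(1) by (simp add: field_simps abs_mult)
qed

text \<open>Since \<open>(u p)' = E - 2 (l - q m\<^sup>2) u\<^sup>2\<close> on each layer, the two parts of the energy have the same
  integral up to the boundary terms \<open>u p\<close>. The product \<open>u p\<close> is continuous, so the interfaces
  contribute nothing; \<open>E 0 (h 0) / F\<close> is a lower bound for all layer energies.\<close>

lemma equipartition:
  assumes ab: "0 \<le> a" "a \<le> b" "b \<le> H"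
  shows "E 0 (h 0) / F * (b - a) - 2 * l * integral {a..b} (\<lambda>y. (u y)\<^sup>2) \<le> u b * p b - u a * p a"
proof -
  \<comment> \<open>At the finitely many interfaces the value of the integrand is irrelevant for the integral; it is
    chosen such that the pointwise lower bound holds everywhere.\<close>
  define f where "f y = (if y \<in> h ` {..Suc N} then E 0 (h 0) / F - 2 * l * (u y)\<^sup>2
      else deriv (\<lambda>y. u y * p y) y)" for y
  have der: "((\<lambda>y. u y * p y) has_real_derivative f y) (at y) \<and> E 0 (h 0) / F - 2 * l * (u y)\<^sup>2 \<le> f y"
    if y: "y \<in> {0..H}" "y \<notin> h ` {..Suc N}" for y
  proof -
    obtain i where i: "i \<le> N" "y \<in> {h i..h (Suc i)}" using in_layer[OF y(1)] .
    have "y \<noteq> h i" "y \<noteq> h (Suc i)" using y(2) i(1) by auto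
    then have y': "y \<in> {h i<..<h (Suc i)}" using i(2) by auto
    have d: "((\<lambda>y. u y * p y) has_real_derivative E i y - 2 * (l - q i * m\<^sup>2) * (u y)\<^sup>2) (at y)"
      by (auto intro!: derivative_eq_intros u_deriv[OF i(1) y'] p_deriv[OF i(1) y']
          simp: E_def power2_eq_square algebra_simps)
    have f: "f y = E i y - 2 * (l - q i * m\<^sup>2) * (u y)\<^sup>2"
      using y(2) DERIV_imp_deriv[OF d] by (simp add: f_def)
    have "E 0 (h 0) / F \<le> E i y"
      using layer_energies_comparable[of 0 i] i E_constant_on_layer[OF i] F_pos
      by (simp add: field_simps)
    moreover have "2 * (l - q i * m\<^sup>2) * (u y)\<^sup>2 \<le> 2 * l * (u y)\<^sup>2"
      using q_pos[OF i(1)] by (intro mult_right_mono) auto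
    ultimately show ?thesis using d f by simp
  qed
  have sub: "{a..b} \<subseteq> {0..H}" using ab by auto
  have "(f has_integral u b * p b - u a * p a) {a..b}"
  proof (rule fundamental_theorem_of_calculus_interior_strong[of "h ` {..Suc N}"])
    show "continuous_on {a..b} (\<lambda>y. u y * p y)"
      by (intro continuous_on_mult continuous_on_subset[OF u_cont sub] continuous_on_subset[OF p_cont sub])
    fix y assume "y \<in> {a<..<b} - h ` {..Suc N}"
    then show "((\<lambda>y. u y * p y) has_vector_derivative f y) (at y)"
      using der[of y] ab by (auto simp: has_real_derivative_iff_has_vector_derivative)
  qed (use ab in auto)
  moreover have "((\<lambda>y. E 0 (h 0) / F - 2 * l * (u y)\<^sup>2) has_integral
      E 0 (h 0) / F * (b - a) - 2 * l * integral {a..b} (\<lambda>y. (u y)\<^sup>2)) {a..b}"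
  proof (intro has_integral_diff has_integral_mult_right)
    show "((\<lambda>y. E 0 (h 0) / F) has_integral E 0 (h 0) / F * (b - a)) {a..b}"
      using has_integral_const_real[of "E 0 (h 0) / F" a b] ab by (simp add: mult.commute)
    show "((\<lambda>y. (u y)\<^sup>2) has_integral integral {a..b} (\<lambda>y. (u y)\<^sup>2)) {a..b}"
      by (intro integrable_integral integrable_continuous_real continuous_intros
          continuous_on_subset[OF u_cont sub])
  qed
  moreover have "E 0 (h 0) / F - 2 * l * (u y)\<^sup>2 \<le> f y" if "y \<in> {a..b}" for y
    using der[of y] that sub by (cases "y \<in> h ` {..Suc N}") (auto simp: f_def)
  ultimately show ?thesis using has_integral_le by blast
qed

text \<open>The threshold for \<open>l\<close> is where the two boundary terms in the equipartition identity eat up at most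
  half of the energy term.\<close>

lemma mass_lower_bound:
  assumes ab: "0 \<le> a" "a < b" "b \<le> H" and H: "0 < H"
    and large: "4 * F ^ 4 * cM / (\<delta> * (b - a)\<^sup>2) < l"
  shows "\<delta> * (b - a) / (4 * F\<^sup>2 * H) \<le> integral {a..b} (\<lambda>y. (u y)\<^sup>2)"
proof -
  let ?L = "b - a" and ?I = "integral {a..b} (\<lambda>y. (u y)\<^sup>2)" and ?s = "sqrt (\<delta> * l)" and ?e = "E 0 (h 0)"
  have s: "0 < ?s" "?s\<^sup>2 = \<delta> * l" using \<delta>_pos l_pos by auto
  have "2 * F\<^sup>2 * sqrt cM \<le> ?s * ?L"
  proof (rule power2_le_imp_le)
    have "4 * F ^ 4 * cM \<le> \<delta> * l * ?L\<^sup>2"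
      using large \<delta>_pos ab by (simp add: field_simps)
    then show "(2 * F\<^sup>2 * sqrt cM)\<^sup>2 \<le> (?s * ?L)\<^sup>2"
      using s(2) cM_pos by (simp add: power_mult_distrib)
  qed (use s ab in auto)
  then have "?e / (2 * F * ?s) * (2 * F\<^sup>2 * sqrt cM) \<le> ?e / (2 * F * ?s) * (?s * ?L)"
    using s F_pos E_nonneg[of 0 "h 0"] by (intro mult_left_mono divide_nonneg_pos) auto
  moreover have "?e / (2 * F * ?s) * (2 * F\<^sup>2 * sqrt cM) = F * ?e * sqrt cM / ?s"
    using F_pos by (simp add: power2_eq_square)
  moreover have "?e / (2 * F * ?s) * (?s * ?L) = ?e / F * (?L / 2)"
  proof -
    have "e / (2 * F * r) * (r * ?L) = e / F * (?L / 2)" if "0 < r" for e r :: real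
      using that by simp
    then show ?thesis using s(1) .
  qed
  ultimately have "F * ?e * sqrt cM / ?s \<le> ?e / F * (?L / 2)" by simp
  moreover have "\<bar>u b * p b\<bar> + \<bar>u a * p a\<bar> \<le> F * ?e * sqrt cM / ?s"
    using flux_bound[of a] flux_bound[of b] ab by simp
  moreover have "?e / F * ?L - 2 * l * ?I \<le> \<bar>u b * p b\<bar> + \<bar>u a * p a\<bar>"
    using equipartition[of a b] ab by simp
  moreover have "x \<le> 4 * l * ?I" if "z \<le> x / 2" "w \<le> z" "x - 2 * l * ?I \<le> w" for x z w
    using that by (simp add: field_simps)
  ultimately have 1: "?e / F * ?L \<le> 4 * l * ?I" by (simp only: times_divide_eq_right)
  have "\<delta> * l / (F * H) \<le> ?e" using energy_lower_bound[OF _ H, of 0] by simp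
  then have "\<delta> * l / (F * H) / F * ?L \<le> ?e / F * ?L"
    using F_pos ab by (intro mult_right_mono divide_right_mono) auto
  with 1 have "\<delta> * l / (F * H) / F * ?L \<le> 4 * l * ?I" by simp
  moreover have "\<delta> * l / (F * H) / F * ?L = 4 * l * (\<delta> * ?L / (4 * F\<^sup>2 * H))"
    using F_pos H by (simp add: field_simps power2_eq_square)
  ultimately have "4 * l * (\<delta> * ?L / (4 * F\<^sup>2 * H)) \<le> 4 * l * ?I" by (simp only:)
  then show ?thesis by (rule mult_left_le_imp_le) (use l_pos in simp)
qed

end

section \<open>Eigenfunctions as layered solutions\<close>

lemma AE_witness_in_interval:
  fixes P :: "real \<Rightarrow> bool"
  assumes ae: "AE y in lebesgue_on {a..b}. P y" and sub: "{\<alpha><..<\<beta>} \<subseteq> {a..b}" and "\<alpha> < \<beta>"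
  shows "\<exists>y\<in>{\<alpha><..<\<beta>}. P y"
proof (rule ccontr)
  assume none: "\<not> ?thesis"
  have "AE y in lebesgue. y \<in> {a..b} \<longrightarrow> P y" using ae by (simp add: AE_restrict_space_iff)
  then have "AE y in lebesgue. y \<notin> {\<alpha><..<\<beta>}"
    by (rule eventually_mono) (use none sub in blast)
  then have "{\<alpha><..<\<beta>} \<in> null_sets lebesgue" by (subst (asm) AE_iff_null_sets[symmetric]) auto
  then have "emeasure lborel {\<alpha><..<\<beta>} = 0" by (simp add: null_sets_def)
  then show False using \<open>\<alpha> < \<beta>\<close> by simp
qed

text \<open>A layer has positive measure, so a bound that holds almost everywhere holds at some point of it,
  and \<open>c\<close> is constant there.\<close>

lemma coeff_class_layer_bounds:
  assumes c: "c \<in> coeff_class H cm cM" and sub: "{\<alpha><..<\<beta>} \<subseteq> {0..H}" and "\<alpha> < \<beta>"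
    and q: "\<And>y. y \<in> {\<alpha><..<\<beta>} \<Longrightarrow> c y = q"
  shows "cm \<le> q" "q \<le> cM"
proof -
  let ?M = "lebesgue_on {0..H}"
  have "esssup ?M (\<lambda>y. ereal (c y)) = ereal cM" using c by (simp add: coeff_class_def)
  then have "AE y in ?M. c y \<le> cM" using esssup_AE[of "\<lambda>y. ereal (c y)" ?M] by simp
  then show "q \<le> cM" using AE_witness_in_interval[OF _ sub \<open>\<alpha> < \<beta>\<close>] q by metis
  have "- esssup ?M (\<lambda>y. - ereal (c y)) = ereal cm" using c by (simp add: coeff_class_def)
  then have "esssup ?M (\<lambda>y. - ereal (c y)) = - ereal cm" by (metis ereal_uminus_uminus)
  then have "AE y in ?M. cm \<le> c y" using esssup_AE[of "\<lambda>y. - ereal (c y)" ?M] by simp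
  then show "cm \<le> q" using AE_witness_in_interval[OF _ sub \<open>\<alpha> < \<beta>\<close>] q by metis
qed

lemma lebesgue_on_open_interval_integral:
  fixes f :: "real \<Rightarrow> real"
  assumes "continuous_on {a..b} f"
  shows "(LINT y|lebesgue_on {a<..<b}. f y) = integral {a..b} f"
proof -
  have "integrable (lebesgue_on {a..b}) f" by (rule continuous_imp_integrable_real[OF assms])
  then have "integrable (lebesgue_on {a<..<b}) f"
    using set_integrable_subset[of lebesgue "{a..b}" f "{a<..<b}"] greaterThanLessThan_subseteq_atLeastAtMost_iff[of a b a b]
    by (simp add: set_integrable_def integrable_restrict_space)
  then show ?thesis
    by (simp add: lebesgue_integral_eq_integral integral_open_interval_real)
qed

lemma eigenfunction_layered_solution:
  assumes c: "c \<in> coeff_class H cm cM" and pc: "piecewise_const H N h q c"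
    and cm: "0 < cm" and eps: "0 < \<epsilon>" and m: "0 < m" and l: "(cM + \<epsilon>) * m\<^sup>2 \<le> l"
    and nf: "normalized_eigenfunction H c m l u p"
  shows "layered_solution H N h q cm cM \<epsilon> m l u p"
proof -
  have h: "h 0 = 0" "h (Suc N) = H" "\<And>i. i \<le> N \<Longrightarrow> h i < h (Suc i)"
    and q: "\<And>i. i \<le> N \<Longrightarrow> 0 < q i"
    and cq: "\<And>i y. i \<le> N \<Longrightarrow> y \<in> {h i<..<h (Suc i)} \<Longrightarrow> c y = q i"
    using pc by (auto simp: piecewise_const_def)
  have sub: "{h i<..<h (Suc i)} \<subseteq> {0<..<H}" "{h i<..<h (Suc i)} \<subseteq> {0..H}" if "i \<le> N" for i
    using partition_points_mono[of N h 0 i] partition_points_mono[of N h "Suc i" "Suc N"] that h by auto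
  have cont: "continuous_on {0..H} u" "continuous_on {0..H} p"
    and norm: "(LINT y|lebesgue_on {0<..<H}. (u y)\<^sup>2) = 1"
    using nf by (auto simp: normalized_eigenfunction_def)
  have u2: "continuous_on {0..H} (\<lambda>y. (u y)\<^sup>2)" by (intro continuous_intros cont)
  show ?thesis
  proof
    show "cm \<le> q i" "q i \<le> cM" if "i \<le> N" for i
      using coeff_class_layer_bounds[OF c sub(2)[OF that] h(3)[OF that]] cq[OF that] by blast+
    fix i y assume iy: "i \<le> N" "y \<in> {h i<..<h (Suc i)}"
    have qi: "q i \<noteq> 0" using q[OF iy(1)] by simp
    note eqs = eigenfunction_layer_equations[OF nf sub(1)[OF iy(1)] cq[OF iy(1)] qi iy(2)]
    show "(u has_real_derivative p y / q i) (at y)" using eqs by blast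
    show "(p has_real_derivative (q i * m\<^sup>2 - l) * u y) (at y)" using eqs by blast
  next
    show "((\<lambda>y. (u y)\<^sup>2) has_integral 1) {0..H}"
      using integrable_integral[OF integrable_continuous_real[OF u2]]
        lebesgue_on_open_interval_integral[OF u2] norm by simp
  qed (use h cm eps m l cont in auto)
qed

lemma family_layered_solution:
  assumes c: "c \<in> coeff_class H cm cM" and pc: "piecewise_const H N h q c"
    and fam: "eigenfunction_family \<mu> H c cM \<epsilon> u p"
    and cm: "0 < cm" and eps: "0 < \<epsilon>" and \<mu>: "0 < \<mu> k"
    and k: "1 \<le> k" "(\<mu> k, l) \<in> A_set \<mu> H c cM \<epsilon>"
  shows "layered_solution H N h q cm cM \<epsilon> (\<mu> k) l (u k l) (p k l)"
proof (rule eigenfunction_layered_solution[OF c pc cm eps \<mu>])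
  show "(cM + \<epsilon>) * (\<mu> k)\<^sup>2 \<le> l" using k(2) by (auto simp: A_set_def)
  show "normalized_eigenfunction H c (\<mu> k) l (u k l) (p k l)"
    using fam k by (simp add: eigenfunction_family_def)
qed

section \<open>Minimal amplitude and mass on subintervals\<close>

theorem proposition5p6:
  fixes \<Omega> :: "(real ^ 'd) set" and \<mu> :: "nat \<Rightarrow> real" and H cm cM \<epsilon> :: real
  assumes "smooth_bounded_domain \<Omega>" and "dirichlet_frequencies \<Omega> \<mu>"
    and "H > 0" and "0 < cm" and "cm < cM" and "\<epsilon> > 0"
  shows
    "(\<forall>c N h q u p.
        c \<in> coeff_class H cm cM \<and> piecewise_const H N h q c \<and>
        eigenfunction_family \<mu> H c cM \<epsilon> u p \<longrightarrow>
        minimal_amplitude \<mu> H (A_set \<mu> H c cM \<epsilon>) u p) \<and>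
     (\<forall>L V. L > 0 \<longrightarrow> (\<exists>d>0. \<exists>l0>0. \<forall>c N h q u p a b.
        c \<in> coeff_class H cm cM \<and> piecewise_const H N h q c \<and> total_variation N q = V \<and>
        eigenfunction_family \<mu> H c cM \<epsilon> u p \<and>
        a < b \<and> {a<..<b} \<subseteq> {0..H} \<and> b - a = L \<longrightarrow>
        (\<forall>k\<ge>1. \<forall>l. (\<mu> k, l) \<in> A_set \<mu> H c cM \<epsilon> \<and> l > l0 \<longrightarrow>
           (LINT y|lebesgue_on {a<..<b}. (u k l y)\<^sup>2) > d)))"
proof (intro conjI allI impI)
  note cm = \<open>0 < cm\<close> and eps = \<open>\<epsilon> > 0\<close> and H = \<open>H > 0\<close>
  have cM: "0 < cM" using \<open>0 < cm\<close> \<open>cm < cM\<close> by simp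
  have \<mu>_pos: "0 < \<mu> k" if "1 \<le> k" for k
    using assms(2) that by (simp add: dirichlet_frequencies_def)
  have \<mu>_first: "(\<mu> 1)\<^sup>2 \<le> (\<mu> k)\<^sup>2" if "1 \<le> k" for k
    using that
  proof (induction k rule: dec_induct)
    case (step n)
    then show ?case using assms(2) by (force simp: dirichlet_frequencies_def intro: order_trans)
  qed simp
  let ?\<delta> = "\<epsilon> / (cM + \<epsilon>)" and ?F = "\<lambda>V. exp ((1 / \<epsilon> + 1 / cm) * V)"
  have \<delta>: "0 < ?\<delta>" using eps cM by simp
  {
    fix c N h q u p
    assume A: "c \<in> coeff_class H cm cM \<and> piecewise_const H N h q c \<and>
        eigenfunction_family \<mu> H c cM \<epsilon> u p"
    \<comment> \<open>The amplitude bound is uniform in the eigenvalue once the flux is weighted by \<open>1 / (l cm)\<close>; the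
      weight is bounded because all \<open>l\<close> are at least \<open>?l1\<close>.\<close>
    let ?l1 = "(cM + \<epsilon>) * (\<mu> 1)\<^sup>2"
    let ?B = "?\<delta> / (?F (total_variation N q) * H)" and ?M = "1 + 1 / (?l1 * cm)"
    have l1: "0 < ?l1" using cM eps \<mu>_pos[of 1] by simp
    have M: "0 < ?M" using l1 cm by (simp add: add_pos_pos)
    have amp: "?B / ?M \<le> (u k l y)\<^sup>2 + (p k l y)\<^sup>2"
      if y: "y \<in> {0..H}" and k: "1 \<le> k" "(\<mu> k, l) \<in> A_set \<mu> H c cM \<epsilon>" for y k l
    proof -
      interpret layered_solution H N h q cm cM \<epsilon> "\<mu> k" l "u k l" "p k l"
        using A family_layered_solution[where \<mu> = \<mu> and k = k, OF _ _ _ cm eps \<mu>_pos[OF k(1)] k] by blast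
      have "?l1 \<le> (cM + \<epsilon>) * (\<mu> k)\<^sup>2"
        using cM eps \<mu>_first[OF k(1)] by (intro mult_left_mono) auto
      then have "?l1 \<le> l" using l_large by simp
      then have "?l1 * cm \<le> l * cm" using cm by (intro mult_right_mono) auto
      then have "(p k l y)\<^sup>2 / (l * cm) \<le> (p k l y)\<^sup>2 / (?l1 * cm)"
        using l1 l_pos cm cM eps by (intro divide_left_mono mult_pos_pos) auto
      moreover have "?B \<le> (u k l y)\<^sup>2 + (p k l y)\<^sup>2 / (l * cm)"
        using amplitude_lower_bound[OF y H] by (simp add: F_def K_def \<delta>_def)
      moreover have "0 \<le> (u k l y)\<^sup>2 / (?l1 * cm)" "0 \<le> (p k l y)\<^sup>2" using l1 cm by simp_all
      moreover have "((u k l y)\<^sup>2 + (p k l y)\<^sup>2) * ?M = (u k l y)\<^sup>2 + (p k l y)\<^sup>2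
          + ((u k l y)\<^sup>2 / (?l1 * cm) + (p k l y)\<^sup>2 / (?l1 * cm))"
        by (simp add: distrib_left add_divide_distrib)
      ultimately have "?B \<le> ((u k l y)\<^sup>2 + (p k l y)\<^sup>2) * ?M"
        by linarith
      then show ?thesis by (rule pos_divide_le_eq[OF M, THEN iffD2])
    qed
    have "0 < ?B" using \<delta> H by (metis divide_pos_pos exp_gt_zero mult_pos_pos)
    then have "0 < ?B / ?M" using M by (rule divide_pos_pos)
    then have "0 < ereal (?B / ?M)" by simp
    also have "\<dots> \<le> (INF (y, k, l) \<in> {(y, k, l). y \<in> {0..H} \<and> k \<ge> 1 \<and> (\<mu> k, l) \<in> A_set \<mu> H c cM \<epsilon>}.
            ereal ((u k l y)\<^sup>2 + (p k l y)\<^sup>2))"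
      by (rule INF_greatest) (use amp in auto)
    finally show "minimal_amplitude \<mu> H (A_set \<mu> H c cM \<epsilon>) u p"
      by (simp add: minimal_amplitude_def)
  next
    fix L V :: real
    assume L: "L > 0"
    \<comment> \<open>One half of the bound for the mass, as the inequality has to be strict.\<close>
    let ?d = "?\<delta> * L / (8 * (?F V)\<^sup>2 * H)" and ?l0 = "4 * ?F V ^ 4 * cM / (?\<delta> * L\<^sup>2)"
    have pos: "0 < r * L / (8 * w\<^sup>2 * H)" "0 < 4 * w ^ 4 * cM / (r * L\<^sup>2)" if "0 < r" "0 < w" for r w :: real
      using that L H cM by auto
    have "0 < ?d" "0 < ?l0" using pos[OF \<delta> exp_gt_zero] by blast+
    moreover have "?d < (LINT y|lebesgue_on {a<..<b}. (u k l y)\<^sup>2)"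
      if A: "c \<in> coeff_class H cm cM \<and> piecewise_const H N h q c \<and> total_variation N q = V \<and>
        eigenfunction_family \<mu> H c cM \<epsilon> u p \<and> a < b \<and> {a<..<b} \<subseteq> {0..H} \<and> b - a = L"
      and k: "1 \<le> k" and kl: "(\<mu> k, l) \<in> A_set \<mu> H c cM \<epsilon> \<and> l > ?l0"
      for c N h q u p a b k l
    proof -
      have ab: "0 \<le> a" "a < b" "b \<le> H"
        using A greaterThanLessThan_subseteq_atLeastAtMost_iff[of a b 0 H] by auto
      interpret layered_solution H N h q cm cM \<epsilon> "\<mu> k" l "u k l" "p k l"
        using A kl family_layered_solution[where \<mu> = \<mu> and k = k, OF _ _ _ cm eps \<mu>_pos[OF k] k] by blast
      have "continuous_on {a..b} (\<lambda>y. (u k l y)\<^sup>2)"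
        using ab by (intro continuous_intros continuous_on_subset[OF u_cont]) auto
      then have eq: "(LINT y|lebesgue_on {a<..<b}. (u k l y)\<^sup>2) = integral {a..b} (\<lambda>y. (u k l y)\<^sup>2)"
        by (rule lebesgue_on_open_interval_integral)
      have "?d < ?\<delta> * L / (4 * (?F V)\<^sup>2 * H)"
      proof -
        have "x / (8 * w * H) < x / (4 * w * H)" if "0 < x" "0 < w" for x w :: real
          using that H by (intro divide_strict_left_mono) auto
        then show ?thesis using \<delta> L by (meson exp_gt_zero mult_pos_pos zero_less_power)
      qed
      also have "\<dots> \<le> integral {a..b} (\<lambda>y. (u k l y)\<^sup>2)"
        using mass_lower_bound[OF ab H] A kl by (simp add: F_def K_def \<delta>_def)
      finally show ?thesis by (simp add: eq)
    qed
    ultimately show "\<exists>d>0. \<exists>l0>0. \<forall>c N h q u p a b.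
        c \<in> coeff_class H cm cM \<and> piecewise_const H N h q c \<and> total_variation N q = V \<and>
        eigenfunction_family \<mu> H c cM \<epsilon> u p \<and>
        a < b \<and> {a<..<b} \<subseteq> {0..H} \<and> b - a = L \<longrightarrow>
        (\<forall>k\<ge>1. \<forall>l. (\<mu> k, l) \<in> A_set \<mu> H c cM \<epsilon> \<and> l > l0 \<longrightarrow>
           (LINT y|lebesgue_on {a<..<b}. (u k l y)\<^sup>2) > d)"
      by blast
  }
qed

end
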